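(* Let $(M_1,F_1)$ and $(M_2,F_2)$ be two Finslerian manifolds of Randers type, that is, for $k\in\{1,2\}$, $F_k:=\alpha_k+\beta_k$ where $\alpha_k$ is a Riemannian metric and $\beta_k$ is a $1$-form on $M_k$ with $\|\beta_k\|_{\alpha_k}<1$. Let $f_k:M_k\to(0,\infty)$, $k\in\{1,2\}$, be smooth functions. If one of the $f_k$ is a nonzero constant function, then the Finslerian convolution metric ${}_{f_2}F_1\star_{f_1}F_2$ on $M_1\times M_2$ is a Randers metric if and only if $$\frac{\alpha_1}{\alpha_2}=\frac{\beta_1}{\beta_2}.$$
   Context: A Finslerian metric on a manifold $M$ is a function $F:TM\to[0,\infty)$ that is $C^\infty$ on the slit tangent bundle $\mathring{T}M$, satisfies $F(x,cy)=cF(x,y)$ for all $c>0$, and has Hessian matrix $g_{ij}(x,y)=\frac12\frac{\partial^2F^2}{\partial y^i\partial y^j}(x,y)$ positive-definite at every point of $\mathring{T}M$. For a product $M=M_1\times M_2$ the slit tangent bundle is $\mathring{T}M=\{(x_1,x_2,y_1,y_2)\in TM: y_1\neq 0,\ y_2\neq 0\}$; on each factor $\mathring{T}M_k$ is $TM_k$ without the zero section. A Randers metric on a manifold $M$ is a Finslerian metric of the form $F=\alpha+\beta$ where, for every $(x,y)\in\mathring{T}M$, $\alpha(x,y)=\sqrt{a_{ij}(x)y^iy^j}$ is a Riemannian metric and $\beta(x,y)=b_i(x)y^i$ is a $1$-form on $M$ with $\|\beta\|_\alpha:=\sqrt{a^{ij}b_ib_j}<1$. Gradient: for a smooth function $u$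 on a Finslerian manifold with Hessian matrix $g$, $\nabla u=g^{ij}(x,y)\frac{\partial u}{\partial x^i}\frac{\partial}{\partial x^j}$. Convolution: the Finslerian convolution of $F_1$ and $F_2$ via $f_1,f_2$ is $F={}_{f_2}F_1\star_{f_1}F_2:T(M_1\times M_2)\to(0,\infty)$ given by $$F^2=f_2^2F_1^2+f_1^2F_2^2+\tfrac12 f_1f_2\,\frac{\partial F_1^2}{\partial y^i}\frac{\partial F_2^2}{\partial y^j}(\nabla f_1)^i(\nabla f_2)^j,$$ where $F_k,f_k$ are pulled back to $M_1\times M_2$ by the projections, $\nabla f_k$ is the gradient with respect to $F_k$, and repeated indices are summed. The identity $\alpha_1/\alpha_2=\beta_1/\beta_2$ is an identity of functions of $(x_1,x_2,y_1,y_2)\in\mathring{T}(M_1\times M_2)$, with $\alpha_k=\alpha_k(x_k,y_k)$, $\beta_k=\beta_k(x_k,y_k)$.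
   Formalization: The identity α₁/α₂ = β₁/β₂ is stated as the proportion α₁β₂ = α₂β₁ for all nonzero y₁, y₂, because the quotient β₁/β₂ is undefined where β₂ vanishes; the two agree wherever β₂ ≠ 0. *)

theory Defs
  imports "HOL-Analysis.Analysis"
begin

section \<open>Smooth maps between open subsets of normed spaces\<close>

primrec Ck_on :: "nat \<Rightarrow> 'a::real_normed_vector set \<Rightarrow> ('a \<Rightarrow> 'b::real_normed_vector) \<Rightarrow> bool" where
  "Ck_on 0 S f \<longleftrightarrow> continuous_on S f"
| "Ck_on (Suc k) S f \<longleftrightarrow>
     (\<forall>x\<in>S. f differentiable (at x)) \<and>
     (\<forall>v. Ck_on k S (\<lambda>x. frechet_derivative f (at x) v))"

text \<open>Only used for open \<open>S\<close>.\<close>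
definition smooth_on :: "'a::real_normed_vector set \<Rightarrow> ('a \<Rightarrow> 'b::real_normed_vector) \<Rightarrow> bool" where
  "smooth_on S f \<longleftrightarrow> (\<forall>k. Ck_on k S f)"

definition partial :: "'e::euclidean_space \<Rightarrow> ('e \<Rightarrow> real) \<Rightarrow> 'e \<Rightarrow> real" where
  "partial i h x = frechet_derivative h (at x) i"

section \<open>Smooth manifolds\<close>

text \<open>
  A chart is a pair of its domain and its coordinate map; the values of the coordinate map
  off the domain are irrelevant. A smooth structure is given by an atlas, which need not be
  maximal.
\<close>

type_synonym ('a, 'e) chart = "'a set \<times> ('a \<Rightarrow> 'e)"

definition chart_inv :: "('a, 'e) chart \<Rightarrow> 'e \<Rightarrow> 'a" where
  "chart_inv c = inv_into (fst c) (snd c)"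

definition smooth_manifold :: "'a topology \<Rightarrow> ('a, 'e::euclidean_space) chart set \<Rightarrow> bool" where
  "smooth_manifold M A \<longleftrightarrow>
     Hausdorff_space M \<and> second_countable M \<and>
     (\<forall>c\<in>A. openin M (fst c) \<and> open (snd c ` fst c) \<and>
        homeomorphic_map (subtopology M (fst c)) (top_of_set (snd c ` fst c)) (snd c)) \<and>
     (\<Union>c\<in>A. fst c) = topspace M \<and>
     (\<forall>c\<in>A. \<forall>d\<in>A. smooth_on (snd c ` (fst c \<inter> fst d)) (snd d \<circ> chart_inv c))"

definition smooth_function :: "('a, 'e::euclidean_space) chart set \<Rightarrow> ('a \<Rightarrow> real) \<Rightarrow> bool" where
  "smooth_function A f \<longleftrightarrow> (\<forall>c\<in>A. smooth_on (snd c ` fst c) (f \<circ> chart_inv c))"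

definition chart_at :: "('a, 'e) chart set \<Rightarrow> 'a \<Rightarrow> ('a, 'e) chart" where
  "chart_at A p = (SOME c. c \<in> A \<and> p \<in> fst c)"

subsection \<open>The tangent bundle\<close>

text \<open>
  A tangent vector at \<open>p\<close> is the family of its coordinate vectors with respect to
  all charts around \<open>p\<close>, related by the differentials of the transition maps
  (and set to \<open>0\<close> on everything that is not a chart around \<open>p\<close>). The vector
  space operations are pointwise.
\<close>

type_synonym ('a, 'e) tvec = "('a, 'e) chart \<Rightarrow> 'e"

definition tangent_space ::
  "('a, 'e::euclidean_space) chart set \<Rightarrow> 'a \<Rightarrow> ('a, 'e) tvec set" where
  "tangent_space A p = {v.
     (\<forall>c\<in>A. \<forall>d\<in>A. p \<in> fst c \<inter> fst d \<longrightarrow>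
        v d = frechet_derivative (snd d \<circ> chart_inv c) (at (snd c p)) (v c)) \<and>
     (\<forall>c. c \<notin> A \<or> p \<notin> fst c \<longrightarrow> v c = 0)}"

definition tangent_bundle ::
  "('a, 'e::euclidean_space) chart set \<Rightarrow> ('a \<times> ('a, 'e) tvec) set" where
  "tangent_bundle A = {(p, v). p \<in> (\<Union>c\<in>A. fst c) \<and> v \<in> tangent_space A p}"

definition slit_bundle ::
  "('a, 'e::euclidean_space) chart set \<Rightarrow> ('a \<times> ('a, 'e) tvec) set" where
  "slit_bundle A = {(p, v). (p, v) \<in> tangent_bundle A \<and> v \<noteq> (\<lambda>_. 0)}"

text \<open>The tangent vector at \<open>p\<close> with coordinates \<open>y\<close> in the chart \<open>c\<close>, i.e.
  \<open>y\<^sup>i \<partial>/\<partial>x\<^sup>i\<close>.\<close>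
definition of_coords ::
  "('a, 'e::euclidean_space) chart set \<Rightarrow> ('a, 'e) chart \<Rightarrow> 'a \<Rightarrow> 'e \<Rightarrow> ('a, 'e) tvec" where
  "of_coords A c p y =
     (\<lambda>d. if d \<in> A \<and> p \<in> fst d
          then frechet_derivative (snd d \<circ> chart_inv c) (at (snd c p)) y else 0)"

text \<open>The differential at \<open>p\<close> of a smooth map between manifolds; it does not depend on the
  chart chosen at \<open>p\<close>.\<close>
definition differential ::
  "('a, 'e::euclidean_space) chart set \<Rightarrow> ('b, 'f::euclidean_space) chart set \<Rightarrow>
   ('a \<Rightarrow> 'b) \<Rightarrow> 'a \<Rightarrow> ('a, 'e) tvec \<Rightarrow> ('b, 'f) tvec" where
  "differential A B h p v =
     (\<lambda>d. if d \<in> B \<and> h p \<in> fst d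
          then (let c = chart_at A p in
                frechet_derivative (snd d \<circ> h \<circ> chart_inv c) (at (snd c p)) (v c))
          else 0)"

subsection \<open>Product manifolds\<close>

definition prod_chart ::
  "('a, 'e) chart \<Rightarrow> ('b, 'f) chart \<Rightarrow> ('a \<times> 'b, 'e \<times> 'f) chart" where
  "prod_chart c d = (fst c \<times> fst d, map_prod (snd c) (snd d))"

definition prod_atlas ::
  "('a, 'e) chart set \<Rightarrow> ('b, 'f) chart set \<Rightarrow> ('a \<times> 'b, 'e \<times> 'f) chart set" where
  "prod_atlas A B = {prod_chart c d | c d. c \<in> A \<and> d \<in> B}"

abbreviation dfst where "dfst A B \<equiv> differential (prod_atlas A B) A fst"
abbreviation dsnd where "dsnd A B \<equiv> differential (prod_atlas A B) B snd"

definition slit_prod_bundle ::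
  "('a, 'e::euclidean_space) chart set \<Rightarrow> ('b, 'f::euclidean_space) chart set \<Rightarrow>
   (('a \<times> 'b) \<times> ('a \<times> 'b, 'e \<times> 'f) tvec) set" where
  "slit_prod_bundle A B = {(p, v). (p, v) \<in> tangent_bundle (prod_atlas A B) \<and>
     dfst A B p v \<noteq> (\<lambda>_. 0) \<and> dsnd A B p v \<noteq> (\<lambda>_. 0)}"

section \<open>Finslerian metrics\<close>

text \<open>Functions on the tangent bundle are curried; their values off it are irrelevant.
  Matrices are functions of two basis vectors of the model space.\<close>

definition pos_def_matrix :: "('e::euclidean_space \<Rightarrow> 'e \<Rightarrow> real) \<Rightarrow> bool" where
  "pos_def_matrix g \<longleftrightarrow>
     (\<forall>i\<in>Basis. \<forall>j\<in>Basis. g i j = g j i) \<and>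
     (\<forall>y. y \<noteq> 0 \<longrightarrow> (\<Sum>i\<in>Basis. \<Sum>j\<in>Basis. g i j * (y \<bullet> i) * (y \<bullet> j)) > 0)"

definition inverse_matrix :: "('e::euclidean_space \<Rightarrow> 'e \<Rightarrow> real) \<Rightarrow> 'e \<Rightarrow> 'e \<Rightarrow> real" where
  "inverse_matrix g = (SOME h. \<forall>i\<in>Basis. \<forall>k\<in>Basis.
     (\<Sum>j\<in>Basis. g i j * h j k) = (if i = k then 1 else 0) \<and>
     (\<Sum>j\<in>Basis. h i j * g j k) = (if i = k then 1 else 0))"

text \<open>\<open>\<partial>F\<^sup>2/\<partial>y\<^sup>i\<close> and \<open>g\<^sub>i\<^sub>j = 1/2 \<partial>\<^sup>2F\<^sup>2/\<partial>y\<^sup>i\<partial>y\<^sup>j\<close> at the point \<open>p\<close> and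
  the tangent vector with coordinates \<open>y\<close> in the chart \<open>c\<close>.\<close>
definition dF2 ::
  "('a, 'e::euclidean_space) chart set \<Rightarrow> ('a \<Rightarrow> ('a, 'e) tvec \<Rightarrow> real) \<Rightarrow>
   ('a, 'e) chart \<Rightarrow> 'a \<Rightarrow> 'e \<Rightarrow> 'e \<Rightarrow> real" where
  "dF2 A F c p y i = partial i (\<lambda>z. (F p (of_coords A c p z))\<^sup>2) y"

definition hessian ::
  "('a, 'e::euclidean_space) chart set \<Rightarrow> ('a \<Rightarrow> ('a, 'e) tvec \<Rightarrow> real) \<Rightarrow>
   ('a, 'e) chart \<Rightarrow> 'a \<Rightarrow> 'e \<Rightarrow> 'e \<Rightarrow> 'e \<Rightarrow> real" where
  "hessian A F c p y i j =
     (1/2) * partial i (\<lambda>z. partial j (\<lambda>w. (F p (of_coords A c p w))\<^sup>2) z) y"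

text \<open>\<open>S\<close> is the slit tangent bundle, which for a product manifold is smaller than
  the complement of the zero section.\<close>
definition finsler_metric ::
  "('a, 'e::euclidean_space) chart set \<Rightarrow> ('a \<times> ('a, 'e) tvec) set \<Rightarrow>
   ('a \<Rightarrow> ('a, 'e) tvec \<Rightarrow> real) \<Rightarrow> bool" where
  "finsler_metric A S F \<longleftrightarrow>
     (\<forall>(p, v)\<in>tangent_bundle A. F p v \<ge> 0) \<and>
     (\<forall>c\<in>A. smooth_on
        {(x, y). x \<in> snd c ` fst c \<and> (chart_inv c x, of_coords A c (chart_inv c x) y) \<in> S}
        (\<lambda>(x, y). F (chart_inv c x) (of_coords A c (chart_inv c x) y))) \<and>
     (\<forall>(p, v)\<in>tangent_bundle A. \<forall>r>0. F p (\<lambda>c. r *\<^sub>R v c) = r * F p v) \<and>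
     (\<forall>(p, v)\<in>S. \<forall>c\<in>A. p \<in> fst c \<longrightarrow> pos_def_matrix (hessian A F c p (v c)))"

text \<open>Components \<open>(\<nabla>u)\<^sup>j = g\<^sup>i\<^sup>j \<partial>u/\<partial>x\<^sup>i\<close> of the gradient in the chart \<open>c\<close>.\<close>
definition gradient ::
  "('a, 'e::euclidean_space) chart set \<Rightarrow> ('a \<Rightarrow> ('a, 'e) tvec \<Rightarrow> real) \<Rightarrow> ('a \<Rightarrow> real) \<Rightarrow>
   ('a, 'e) chart \<Rightarrow> 'a \<Rightarrow> 'e \<Rightarrow> 'e \<Rightarrow> real" where
  "gradient A F u c p y j =
     (\<Sum>i\<in>Basis. inverse_matrix (hessian A F c p y) i j * partial i (u \<circ> chart_inv c) (snd c p))"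

text \<open>The Finslerian convolution of \<open>F1\<close> and \<open>F2\<close> via \<open>f1\<close>, \<open>f2\<close>; the mixed term is
  the same in all charts.\<close>
definition convolution ::
  "('a, 'e::euclidean_space) chart set \<Rightarrow> ('b, 'f::euclidean_space) chart set \<Rightarrow>
   ('a \<Rightarrow> ('a, 'e) tvec \<Rightarrow> real) \<Rightarrow> ('b \<Rightarrow> ('b, 'f) tvec \<Rightarrow> real) \<Rightarrow>
   ('a \<Rightarrow> real) \<Rightarrow> ('b \<Rightarrow> real) \<Rightarrow>
   'a \<times> 'b \<Rightarrow> ('a \<times> 'b, 'e \<times> 'f) tvec \<Rightarrow> real" where
  "convolution A1 A2 F1 F2 f1 f2 p v =
     (let x1 = fst p; x2 = snd p;
          v1 = dfst A1 A2 p v; v2 = dsnd A1 A2 p v;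
          c1 = chart_at A1 x1; c2 = chart_at A2 x2;
          y1 = v1 c1; y2 = v2 c2
      in sqrt ((f2 x2)\<^sup>2 * (F1 x1 v1)\<^sup>2 + (f1 x1)\<^sup>2 * (F2 x2 v2)\<^sup>2 +
           (1/2) * f1 x1 * f2 x2 *
           (\<Sum>i\<in>Basis. \<Sum>j\<in>Basis. dF2 A1 F1 c1 x1 y1 i * dF2 A2 F2 c2 x2 y2 j *
              gradient A1 F1 f1 c1 x1 y1 i * gradient A2 F2 f2 c2 x2 y2 j)))"

section \<open>Randers metrics\<close>

definition riemannian_metric ::
  "('a, 'e::euclidean_space) chart set \<Rightarrow> ('a \<Rightarrow> ('a, 'e) tvec \<Rightarrow> ('a, 'e) tvec \<Rightarrow> real) \<Rightarrow> bool" where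
  "riemannian_metric A a \<longleftrightarrow>
     (\<forall>c\<in>A. \<forall>p\<in>fst c.
        bilinear (\<lambda>y z. a p (of_coords A c p y) (of_coords A c p z)) \<and>
        pos_def_matrix (\<lambda>i j. a p (of_coords A c p i) (of_coords A c p j))) \<and>
     (\<forall>c\<in>A. \<forall>i\<in>Basis. \<forall>j\<in>Basis. smooth_on (snd c ` fst c)
        (\<lambda>x. a (chart_inv c x) (of_coords A c (chart_inv c x) i) (of_coords A c (chart_inv c x) j)))"

definition one_form ::
  "('a, 'e::euclidean_space) chart set \<Rightarrow> ('a \<Rightarrow> ('a, 'e) tvec \<Rightarrow> real) \<Rightarrow> bool" where
  "one_form A b \<longleftrightarrow>
     (\<forall>c\<in>A. \<forall>p\<in>fst c. linear (\<lambda>y. b p (of_coords A c p y))) \<and>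
     (\<forall>c\<in>A. \<forall>i\<in>Basis. smooth_on (snd c ` fst c)
        (\<lambda>x. b (chart_inv c x) (of_coords A c (chart_inv c x) i)))"

definition riem_norm ::
  "('a \<Rightarrow> ('a, 'e) tvec \<Rightarrow> ('a, 'e) tvec \<Rightarrow> real) \<Rightarrow> 'a \<Rightarrow> ('a, 'e) tvec \<Rightarrow> real" where
  "riem_norm a p v = sqrt (a p v v)"

text \<open>The square root of \<open>a\<^sup>i\<^sup>j b\<^sub>i b\<^sub>j\<close>.\<close>
definition form_norm ::
  "('a, 'e::euclidean_space) chart set \<Rightarrow> ('a \<Rightarrow> ('a, 'e) tvec \<Rightarrow> ('a, 'e) tvec \<Rightarrow> real) \<Rightarrow>
   ('a \<Rightarrow> ('a, 'e) tvec \<Rightarrow> real) \<Rightarrow> 'a \<Rightarrow> real" where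
  "form_norm A a b p =
     (let c = chart_at A p; e = of_coords A c p
      in sqrt (\<Sum>i\<in>Basis. \<Sum>j\<in>Basis.
           inverse_matrix (\<lambda>i j. a p (e i) (e j)) i j * b p (e i) * b p (e j)))"

definition randers_with ::
  "('a, 'e::euclidean_space) chart set \<Rightarrow> ('a \<times> ('a, 'e) tvec) set \<Rightarrow>
   ('a \<Rightarrow> ('a, 'e) tvec \<Rightarrow> ('a, 'e) tvec \<Rightarrow> real) \<Rightarrow> ('a \<Rightarrow> ('a, 'e) tvec \<Rightarrow> real) \<Rightarrow>
   ('a \<Rightarrow> ('a, 'e) tvec \<Rightarrow> real) \<Rightarrow> bool" where
  "randers_with A S a b F \<longleftrightarrow>
     finsler_metric A S F \<and> riemannian_metric A a \<and> one_form A b \<and>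
     (\<forall>p\<in>(\<Union>c\<in>A. fst c). form_norm A a b p < 1) \<and>
     (\<forall>(p, v)\<in>S. F p v = riem_norm a p v + b p v)"

definition randers_metric ::
  "('a, 'e::euclidean_space) chart set \<Rightarrow> ('a \<times> ('a, 'e) tvec) set \<Rightarrow>
   ('a \<Rightarrow> ('a, 'e) tvec \<Rightarrow> real) \<Rightarrow> bool" where
  "randers_metric A S F \<longleftrightarrow> (\<exists>a b. randers_with A S a b F)"

text \<open>
  The identity \<open>a/b = c/d\<close> read as a proportion \<open>a : b = c : d\<close>. Forms have zeros, so
  \<open>c\<close> and \<open>d\<close> may vanish; with \<open>x/0 = 0\<close> the literal quotients would make the
  identity fail for \<open>c = d = 0\<close>, i.e. for a pair of Riemannian metrics.
\<close>
definition same_ratio :: "real \<Rightarrow> real \<Rightarrow> real \<Rightarrow> real \<Rightarrow> bool" where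
  "same_ratio a b c d \<longleftrightarrow> a * d = b * c"

lemma same_ratio_iff_divide:
  assumes "b \<noteq> 0" "d \<noteq> 0"
  shows "same_ratio a b c d \<longleftrightarrow> a / b = c / d"
  using assms by (auto simp: same_ratio_def field_simps)

section \<open>The product of two smooth manifolds is a smooth manifold\<close>

lemma Ck_on_cong:
  assumes "open S" "\<And>x. x \<in> S \<Longrightarrow> f x = g x" "Ck_on k S f"
  shows "Ck_on k S g"
  using assms(2,3)
proof (induction k arbitrary: f g)
  case 0
  then show ?case by (simp cong: continuous_on_cong)
next
  case (Suc k)
  have d: "g differentiable (at x)" if "x \<in> S" for x
  proof -
    have "(f has_derivative frechet_derivative f (at x)) (at x)"
      using Suc.prems(2) that by (simp flip: frechet_derivative_works)
    then have "(g has_derivative frechet_derivative f (at x)) (at x)"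
      by (rule has_derivative_transform_within_open[OF _ assms(1) that]) (use Suc.prems(1) in blast)
    then show ?thesis
      by (rule differentiableI)
  qed
  have e: "frechet_derivative f (at x) = frechet_derivative g (at x)" if "x \<in> S" for x
    by (rule frechet_derivative_transform_within_open[OF _ assms(1) that])
      (use Suc.prems that in auto)
  show ?case
    unfolding Ck_on.simps
  proof (intro conjI ballI allI)
    show "Ck_on k S (\<lambda>x. frechet_derivative g (at x) v)" for v
    proof (rule Suc.IH)
      show "Ck_on k S (\<lambda>x. frechet_derivative f (at x) v)"
        using Suc.prems(2) by simp
    qed (simp add: e)
  qed (rule d)
qed

lemma Ck_on_map_prod:
  assumes "open S" "open T" "Ck_on k S f" "Ck_on k T g"
  shows "Ck_on k (S \<times> T) (map_prod f g)"
  using assms(3,4)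
proof (induction k arbitrary: f g)
  case 0
  then show ?case
    by (auto simp: map_prod_def case_prod_unfold intro!: continuous_on_Pair
        intro: continuous_on_compose2[OF _ continuous_on_fst[OF continuous_on_id]]
          continuous_on_compose2[OF _ continuous_on_snd[OF continuous_on_id]])
next
  case (Suc k)
  have D: "(map_prod f g has_derivative
      (\<lambda>v. (frechet_derivative f (at (fst x)) (fst v), frechet_derivative g (at (snd x)) (snd v)))) (at x)"
    if x: "x \<in> S \<times> T" for x
  proof -
    have f: "(f has_derivative frechet_derivative f (at (fst x))) (at (fst x))"
      and g: "(g has_derivative frechet_derivative g (at (snd x))) (at (snd x))"
      using Suc.prems x by (auto simp: frechet_derivative_works)
    have p: "(fst has_derivative fst) (at x)" "(snd has_derivative snd) (at x)"
      by (simp_all add: bounded_linear_imp_has_derivative bounded_linear_fst bounded_linear_snd)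
    have "((\<lambda>z. (f (fst z), g (snd z))) has_derivative
      (\<lambda>v. (frechet_derivative f (at (fst x)) (fst v), frechet_derivative g (at (snd x)) (snd v)))) (at x)"
      by (rule has_derivative_Pair[OF diff_chain_at[OF p(1) f, unfolded comp_def]
            diff_chain_at[OF p(2) g, unfolded comp_def]])
    then show ?thesis by (simp add: map_prod_def case_prod_unfold)
  qed
  have "Ck_on k (S \<times> T) (\<lambda>x. frechet_derivative (map_prod f g) (at x) v)" for v
  proof (rule Ck_on_cong)
    show "Ck_on k (S \<times> T) (map_prod (\<lambda>x. frechet_derivative f (at x) (fst v))
                                  (\<lambda>x. frechet_derivative g (at x) (snd v)))"
      using Suc by auto
    show "map_prod (\<lambda>x. frechet_derivative f (at x) (fst v))
            (\<lambda>x. frechet_derivative g (at x) (snd v)) x = frechet_derivative (map_prod f g) (at x) v"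
      if "x \<in> S \<times> T" for x
      using frechet_derivative_at[OF D[OF that], symmetric] by (auto simp: case_prod_unfold map_prod_def)
  qed (use assms in \<open>auto intro: open_Times\<close>)
  then show ?case
    unfolding Ck_on.simps using D differentiable_def by blast
qed

lemma second_countable_prod:
  assumes "second_countable X" "second_countable Y"
  shows "second_countable (prod_topology X Y)"
proof -
  obtain B where B: "countable B" "\<forall>V\<in>B. openin X V"
      "\<forall>U x. openin X U \<and> x \<in> U \<longrightarrow> (\<exists>V\<in>B. x \<in> V \<and> V \<subseteq> U)"
    using assms(1) unfolding second_countable_def by blast
  obtain C where C: "countable C" "\<forall>V\<in>C. openin Y V"
      "\<forall>U x. openin Y U \<and> x \<in> U \<longrightarrow> (\<exists>V\<in>C. x \<in> V \<and> V \<subseteq> U)"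
    using assms(2) unfolding second_countable_def by blast
  let ?D = "(\<lambda>(U, V). U \<times> V) ` (B \<times> C)"
  have "\<exists>V\<in>?D. z \<in> V \<and> V \<subseteq> W" if W: "openin (prod_topology X Y) W" "z \<in> W" for W z
  proof -
    obtain x y where z: "z = (x, y)" by fastforce
    obtain U V where UV: "openin X U" "openin Y V" "x \<in> U" "y \<in> V" "U \<times> V \<subseteq> W"
      using W(1)[unfolded openin_prod_topology_alt, rule_format, of x y] W(2) z by auto
    obtain U' where U': "U' \<in> B" "x \<in> U'" "U' \<subseteq> U"
      using B(3)[rule_format, of U x] UV by auto
    obtain V' where V': "V' \<in> C" "y \<in> V'" "V' \<subseteq> V"
      using C(3)[rule_format, of V y] UV by auto
    show ?thesis
    proof (intro bexI conjI)
      show "U' \<times> V' \<in> ?D" using U' V' by force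
      show "z \<in> U' \<times> V'" using U' V' z by simp
      show "U' \<times> V' \<subseteq> W" using Sigma_mono[of U' U "\<lambda>_. V'" "\<lambda>_. V"] U' V' UV(5) by auto
    qed
  qed
  moreover have "countable ?D" "\<forall>V\<in>?D. openin (prod_topology X Y) V"
    using B C by (auto simp: openin_prod_Times_iff)
  ultimately show ?thesis
    unfolding second_countable_def by (intro exI[of _ ?D]) simp
qed

lemma chart_inv_prod_chart:
  assumes "inj_on (snd c) (fst c)" "inj_on (snd d) (fst d)"
    and "x \<in> snd c ` fst c" "y \<in> snd d ` fst d"
  shows "chart_inv (prod_chart c d) (x, y) = (chart_inv c x, chart_inv d y)"
proof -
  obtain p q where p: "p \<in> fst c" "x = snd c p" and q: "q \<in> fst d" "y = snd d q"
    using assms by auto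
  have "inj_on (map_prod (snd c) (snd d)) (fst c \<times> fst d)"
    using assms by (auto simp: inj_on_def)
  then have "chart_inv (prod_chart c d) (map_prod (snd c) (snd d) (p, q)) = (p, q)"
    unfolding chart_inv_def prod_chart_def using p q by (simp only: fst_conv snd_conv, intro inv_into_f_f) auto
  moreover have "chart_inv c x = p" "chart_inv d y = q"
    using p q assms by (auto simp: chart_inv_def)
  ultimately show ?thesis
    using p q by simp
qed

lemma chart_props:
  assumes "smooth_manifold M A" "c \<in> A"
  shows "openin M (fst c)" "open (snd c ` fst c)"
    "homeomorphic_map (subtopology M (fst c)) (top_of_set (snd c ` fst c)) (snd c)"
  using assms unfolding smooth_manifold_def by simp_all

lemma transition_smooth:
  assumes "smooth_manifold M A" "c \<in> A" "d \<in> A"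
  shows "smooth_on (snd c ` (fst c \<inter> fst d)) (snd d \<circ> chart_inv c)"
  using assms unfolding smooth_manifold_def by simp

lemma open_overlap:
  assumes "smooth_manifold M A" "c \<in> A" "d \<in> A"
  shows "open (snd c ` (fst c \<inter> fst d))"
proof -
  note c = chart_props[OF assms(1,2)] and d = chart_props(1)[OF assms(1,3)]
  have "openin (subtopology M (fst c)) (fst c \<inter> fst d)"
    using d by (auto simp: openin_subtopology_Int2)
  then have "openin (top_of_set (snd c ` fst c)) (snd c ` (fst c \<inter> fst d))"
    using c(3) homeomorphic_imp_open_map open_map_def by blast
  then show ?thesis
    using c(2) openin_open_eq by blast
qed

lemma chart_inj:
  assumes "smooth_manifold M A" "c \<in> A"
  shows "inj_on (snd c) (fst c)"
proof -
  note c = chart_props(1,3)[OF assms]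
  have "topspace (subtopology M (fst c)) = fst c"
    using openin_subset[OF c(1)] by auto
  then show ?thesis
    using homeomorphic_imp_injective_map[OF c(2)] by simp
qed

lemma smooth_manifold_prod:
  assumes M1: "smooth_manifold M1 A1" and M2: "smooth_manifold M2 A2"
  shows "smooth_manifold (prod_topology M1 M2) (prod_atlas A1 A2)"
  unfolding smooth_manifold_def
proof (intro conjI ballI)
  show "Hausdorff_space (prod_topology M1 M2)" "second_countable (prod_topology M1 M2)"
    using M1[unfolded smooth_manifold_def, THEN conjunct1]
      M2[unfolded smooth_manifold_def, THEN conjunct1]
      M1[unfolded smooth_manifold_def, THEN conjunct2, THEN conjunct1]
      M2[unfolded smooth_manifold_def, THEN conjunct2, THEN conjunct1]
    by (simp_all add: Hausdorff_space_prod_topology second_countable_prod)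
  show "(\<Union>c\<in>prod_atlas A1 A2. fst c) = topspace (prod_topology M1 M2)"
  proof -
    have "topspace M1 = (\<Union>c\<in>A1. fst c)" "topspace M2 = (\<Union>d\<in>A2. fst d)"
      using M1[unfolded smooth_manifold_def] M2[unfolded smooth_manifold_def] by simp_all
    moreover have "(\<Union>c\<in>prod_atlas A1 A2. fst c) = (\<Union>c\<in>A1. fst c) \<times> (\<Union>d\<in>A2. fst d)"
    proof -
      have "prod_atlas A1 A2 = (\<Union>c\<in>A1. \<Union>d\<in>A2. {prod_chart c d})"
        unfolding prod_atlas_def by blast
      then show ?thesis
        by (auto simp: prod_chart_def)
    qed
    ultimately show ?thesis by simp
  qed
next
  fix e assume "e \<in> prod_atlas A1 A2"
  then obtain c d where e: "e = prod_chart c d" and cd: "c \<in> A1" "d \<in> A2"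
    by (auto simp: prod_atlas_def)
  note c = chart_props[OF M1 cd(1)] and d = chart_props[OF M2 cd(2)]
  have im: "snd e ` fst e = snd c ` fst c \<times> snd d ` fst d"
    by (auto simp: e prod_chart_def)
  show "openin (prod_topology M1 M2) (fst e)"
    using c d by (simp add: e prod_chart_def openin_prod_Times_iff)
  show "open (snd e ` fst e)"
    using c d by (simp add: im open_Times)
  obtain f where f: "homeomorphic_maps (subtopology M1 (fst c)) (top_of_set (snd c ` fst c)) (snd c) f"
    using c(3) unfolding homeomorphic_map_maps by (rule exE)
  obtain g where g: "homeomorphic_maps (subtopology M2 (fst d)) (top_of_set (snd d ` fst d)) (snd d) g"
    using d(3) unfolding homeomorphic_map_maps by (rule exE)
  from f g have "homeomorphic_maps
      (prod_topology (subtopology M1 (fst c)) (subtopology M2 (fst d)))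
      (prod_topology (top_of_set (snd c ` fst c)) (top_of_set (snd d ` fst d)))
      (\<lambda>(x, y). (snd c x, snd d y)) (\<lambda>(x, y). (f x, g y))"
    unfolding homeomorphic_maps_prod by (intro disjI2 conjI)
  then show "homeomorphic_map (subtopology (prod_topology M1 M2) (fst e))
      (top_of_set (snd e ` fst e)) (snd e)"
    unfolding im unfolding homeomorphic_map_maps e prod_chart_def fst_conv snd_conv map_prod_def
      subtopology_Times prod_topology_subtopology_eu by (rule exI[of _ "\<lambda>(x, y). (f x, g y)"])
next
  fix e e' assume "e \<in> prod_atlas A1 A2" "e' \<in> prod_atlas A1 A2"
  then obtain c d c' d' where e: "e = prod_chart c d" "e' = prod_chart c' d'"
    and cd: "c \<in> A1" "d \<in> A2" "c' \<in> A1" "d' \<in> A2"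
    by (auto simp: prod_atlas_def)
  let ?S = "snd c ` (fst c \<inter> fst c')" and ?T = "snd d ` (fst d \<inter> fst d')"
  have o: "open ?S" "open ?T"
    using open_overlap[OF M1 cd(1,3)] open_overlap[OF M2 cd(2,4)] .
  have im: "snd e ` (fst e \<inter> fst e') = ?S \<times> ?T"
    unfolding e prod_chart_def fst_conv snd_conv Times_Int_Times map_prod_surj_on[OF refl refl] ..
  note s = transition_smooth[OF M1 cd(1,3)] transition_smooth[OF M2 cd(2,4)]
  have eq: "map_prod (snd c' \<circ> chart_inv c) (snd d' \<circ> chart_inv d) z = (snd e' \<circ> chart_inv e) z"
    if z: "z \<in> ?S \<times> ?T" for z
  proof -
    obtain x y where xy: "z = (x, y)" "x \<in> ?S" "y \<in> ?T" using z by auto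
    then have "chart_inv e z = (chart_inv c x, chart_inv d y)"
      unfolding e xy(1)
      by (intro chart_inv_prod_chart chart_inj[OF M1] chart_inj[OF M2]) (use cd in auto)
    then show ?thesis
      by (simp add: e xy(1) prod_chart_def)
  qed
  show "smooth_on (snd e ` (fst e \<inter> fst e')) (snd e' \<circ> chart_inv e)"
    unfolding im smooth_on_def
  proof
    fix k
    show "Ck_on k (?S \<times> ?T) (snd e' \<circ> chart_inv e)"
      by (rule Ck_on_cong[OF open_Times[OF o] eq Ck_on_map_prod[OF o]])
        (use s in \<open>auto simp: smooth_on_def\<close>)
  qed
qed

end

theory Submission
  imports Defs
begin

text \<open>
  If \<open>f\<^sub>1\<close> or \<open>f\<^sub>2\<close> is constant, its gradient vanishes, so the mixed term of the
  convolution drops out and \<open>F\<^sup>2 = f\<^sub>2\<^sup>2 F\<^sub>1\<^sup>2 + f\<^sub>1\<^sup>2 F\<^sub>2\<^sup>2\<close>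
  (\<open>convolution_eq_doubly_warped_product\<close>).

  The condition \<open>\<alpha>\<^sub>1 : \<alpha>\<^sub>2 = \<beta>\<^sub>1 : \<beta>\<^sub>2\<close> on all pairs of nonzero vectors says that both
  forms vanish: replacing \<open>y\<^sub>1\<close> by \<open>-y\<^sub>1\<close> changes the sign of \<open>\<beta>\<^sub>1\<close> but fixes \<open>\<alpha>\<^sub>1\<close>,
  and the norms are positive (\<open>same_ratio_iff_forms_vanish\<close>). So the claim is that the doubly
  warped product is a Randers metric exactly if \<open>\<beta>\<^sub>1 = \<beta>\<^sub>2 = 0\<close>, apart from the case
  where one of the manifolds is empty and everything holds vacuously.

  If the forms vanish, then \<open>F\<^sup>2\<close> is the quadratic form of the Riemannian metric
  \<open>f\<^sub>2\<^sup>2 a\<^sub>1 + f\<^sub>1\<^sup>2 a\<^sub>2\<close>, and \<open>F\<close> is a Randers metric with zero form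
  (\<open>forms_vanish_imp_warped_randers\<close>). Its Hessian is that metric, and its smoothness away from
  \<open>y\<^sub>1 = 0\<close> and \<open>y\<^sub>2 = 0\<close> is that of a square root of a positive smooth function.

  Conversely, suppose that \<open>F = \<alpha> + \<beta>\<close> is a Randers metric
  (\<open>warped_randers_imp_forms_vanish\<close>). Fix nonzero \<open>y\<^sub>1\<close>, \<open>y\<^sub>2\<close> and restrict to
  the vectors \<open>(s y\<^sub>1, t y\<^sub>2)\<close>: there \<open>\<alpha>\<^sup>2\<close> is a binary quadratic form \<open>Q\<close>, \<open>\<beta>\<close> is a
  linear form \<open>L\<close>, and with \<open>q = f\<^sub>2 \<alpha>\<^sub>1\<close>, \<open>\<lambda> = f\<^sub>2 \<beta>\<^sub>1\<close>,
  \<open>p = f\<^sub>1 \<alpha>\<^sub>2\<close>, \<open>\<mu> = f\<^sub>1 \<beta>\<^sub>2\<close> the identity reads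
  \[\sqrt{Q(s,t)} + L(s,t) = \sqrt{(|s| q + s \lambda)^2 + (|t| p + t \mu)^2}, \qquad s, t \neq 0.\]
  Letting \<open>t\<close> or \<open>s\<close> tend to \<open>0\<close> identifies \<open>Q\<close> and \<open>L\<close> on the axes. Squaring and
  splitting into even and odd parts under \<open>(s,t) \<mapsto> (-s,-t)\<close> then fixes the mixed coefficient of
  \<open>Q\<close> and leaves a relation in \<open>t\<close> that is impossible unless \<open>\<lambda> = \<mu> = 0\<close>
  (\<open>binary_randers_norm_forms_vanish\<close>).
\<close>

section \<open>Rules for smooth functions\<close>

lemma smooth_on_const: "smooth_on S (\<lambda>x. c)"
proof -
  have "Ck_on k S (\<lambda>x. c)" for k and c :: 'b
    by (induction k arbitrary: c) (auto simp: frechet_derivative_const)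
  then show ?thesis by (simp add: smooth_on_def)
qed

lemma smooth_on_empty: "smooth_on {} f"
proof -
  have "Ck_on k {} f" for k
    by (induction k arbitrary: f) auto
  then show ?thesis by (simp add: smooth_on_def)
qed

lemma Ck_on_SucD:
  assumes "Ck_on (Suc k) S f"
  shows "Ck_on k S f"
  using assms
proof (induction k arbitrary: f)
  case 0
  then show ?case
    by (auto intro!: continuous_at_imp_continuous_on differentiable_imp_continuous_within)
next
  case (Suc k)
  from Suc.prems have "\<forall>v. Ck_on (Suc k) S (\<lambda>x. frechet_derivative f (at x) v)"
    unfolding Ck_on.simps(2)[of "Suc k"] by blast
  then have "\<forall>v. Ck_on k S (\<lambda>x. frechet_derivative f (at x) v)"
    using Suc.IH by blast
  with Suc.prems show ?case
    by simp
qed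

text \<open>
  The induction step of every closure property below: a candidate derivative given by a formula
  stands for the Frechet derivative, and only its values at points of \<open>S\<close> matter.
\<close>
lemma Ck_on_SucI:
  assumes "open S"
    and "\<And>x. x \<in> S \<Longrightarrow> (f has_derivative D x) (at x)"
    and "\<And>v. Ck_on k S (\<lambda>x. D x v)"
  shows "Ck_on (Suc k) S f"
proof -
  have "Ck_on k S (\<lambda>x. frechet_derivative f (at x) v)" for v
    by (rule Ck_on_cong[OF assms(1) _ assms(3)]) (simp flip: frechet_derivative_at[OF assms(2)])
  then show ?thesis
    using assms(2) by (auto intro: differentiableI)
qed

lemma Ck_on_has_derivative:
  assumes "Ck_on (Suc k) S f" "x \<in> S"
  shows "(f has_derivative frechet_derivative f (at x)) (at x)"
  using assms by (simp add: frechet_derivative_works)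

lemma Ck_on_add:
  assumes "open S" "Ck_on k S f" "Ck_on k S g"
  shows "Ck_on k S (\<lambda>x. f x + g x)"
  using assms(2,3)
proof (induction k arbitrary: f g)
  case (Suc k)
  show ?case
    by (rule Ck_on_SucI[OF assms(1) has_derivative_add[OF Ck_on_has_derivative[OF Suc.prems(1)]
            Ck_on_has_derivative[OF Suc.prems(2)]]])
      (use Suc in auto)
qed (simp add: continuous_intros)

lemma Ck_on_mult:
  fixes f g :: "'a::real_normed_vector \<Rightarrow> real"
  assumes "open S" "Ck_on k S f" "Ck_on k S g"
  shows "Ck_on k S (\<lambda>x. f x * g x)"
  using assms(2,3)
proof (induction k arbitrary: f g)
  case (Suc k)
  note c = Ck_on_SucD[OF Suc.prems(1)] Ck_on_SucD[OF Suc.prems(2)]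
  show ?case
    by (rule Ck_on_SucI[OF assms(1) has_derivative_mult[OF Ck_on_has_derivative[OF Suc.prems(1)]
            Ck_on_has_derivative[OF Suc.prems(2)]]])
      (use Suc c in \<open>auto intro!: Ck_on_add[OF assms(1)]\<close>)
qed (simp add: continuous_intros)

text \<open>
  The derivative of \<open>1/f\<close> is \<open>- f' (1/f)\<^sup>2\<close>, in which \<open>1/f\<close> itself occurs one order lower,
  so the product rule closes the induction. The same happens for square roots, whose derivative
  is \<open>f' / (2 \<surd>f)\<close>.
\<close>
lemma Ck_on_inverse:
  fixes f :: "'a::real_normed_vector \<Rightarrow> real"
  assumes "open S" "\<And>x. x \<in> S \<Longrightarrow> f x \<noteq> 0" "Ck_on k S f"
  shows "Ck_on k S (\<lambda>x. inverse (f x))"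
  using assms(2,3)
proof (induction k arbitrary: f)
  case (Suc k)
  have i: "Ck_on k S (\<lambda>x. inverse (f x))"
    using Suc.IH Suc.prems(1) Ck_on_SucD[OF Suc.prems(2)] by blast
  have m: "Ck_on k S (\<lambda>x. - 1)"
    using smooth_on_const unfolding smooth_on_def by blast
  have "Ck_on k S (\<lambda>x. - 1 * (inverse (f x) * frechet_derivative f (at x) v * inverse (f x)))" for v
    by (intro Ck_on_mult[OF assms(1)] m i) (use Suc.prems in auto)
  then show ?case
    by (intro Ck_on_SucI[OF assms(1) Deriv.has_derivative_inverse[OF Suc.prems(1) Ck_on_has_derivative[OF Suc.prems(2)]]])
      auto
qed (simp add: continuous_intros)

lemma Ck_on_sqrt:
  assumes "open S" "\<And>x. x \<in> S \<Longrightarrow> f x > 0" "Ck_on k S f"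
  shows "Ck_on k S (\<lambda>x. sqrt (f x))"
  using assms(2,3)
proof (induction k arbitrary: f)
  case (Suc k)
  have s: "Ck_on k S (\<lambda>x. sqrt (f x))"
    using Suc.IH Suc.prems(1) Ck_on_SucD[OF Suc.prems(2)] by blast
  have i: "Ck_on k S (\<lambda>x. inverse (sqrt (f x)))"
    by (rule Ck_on_inverse[OF assms(1) _ s]) (use Suc.prems(1) in force)
  have m: "Ck_on k S (\<lambda>x. 1/2)"
    using smooth_on_const unfolding smooth_on_def by blast
  have "Ck_on k S (\<lambda>x. frechet_derivative f (at x) v * (inverse (sqrt (f x)) * (1/2)))" for v
    by (intro Ck_on_mult[OF assms(1)] m i) (use Suc.prems in auto)
  then show ?case
    by (intro Ck_on_SucI[OF assms(1) has_derivative_real_sqrt[OF Suc.prems(1) Ck_on_has_derivative[OF Suc.prems(2)]]])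
      (auto simp: field_simps)
qed (simp add: continuous_intros)

lemma Ck_on_compose_linear:
  assumes "open S" "bounded_linear h" "Ck_on k T f" "h ` S \<subseteq> T"
  shows "Ck_on k S (\<lambda>x. f (h x))"
  using assms(3)
proof (induction k arbitrary: f)
  case 0
  then show ?case
    using assms(4) linear_continuous_on[OF assms(2), of S] by (auto intro: continuous_on_compose2)
next
  case (Suc k)
  have "((\<lambda>x. f (h x)) has_derivative (\<lambda>v. frechet_derivative f (at (h x)) (h v))) (at x)" if "x \<in> S" for x
    using diff_chain_at[OF bounded_linear_imp_has_derivative[OF assms(2)]
        Ck_on_has_derivative[OF Suc.prems]] that assms(4)
    by (auto simp: comp_def image_subset_iff)
  then show ?case
    by (rule Ck_on_SucI[OF assms(1)]) (use Suc in auto)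
qed

lemma smooth_on_cong:
  assumes "open S" "\<And>x. x \<in> S \<Longrightarrow> f x = g x" "smooth_on S f"
  shows "smooth_on S g"
  using assms Ck_on_cong unfolding smooth_on_def by blast

lemma smooth_on_add:
  "open S \<Longrightarrow> smooth_on S f \<Longrightarrow> smooth_on S g \<Longrightarrow> smooth_on S (\<lambda>x. f x + g x)"
  unfolding smooth_on_def by (blast intro: Ck_on_add)

lemma smooth_on_mult:
  fixes f g :: "'a::real_normed_vector \<Rightarrow> real"
  shows "open S \<Longrightarrow> smooth_on S f \<Longrightarrow> smooth_on S g \<Longrightarrow> smooth_on S (\<lambda>x. f x * g x)"
  unfolding smooth_on_def by (blast intro: Ck_on_mult)

lemma smooth_on_sqrt:
  "open S \<Longrightarrow> (\<And>x. x \<in> S \<Longrightarrow> f x > 0) \<Longrightarrow> smooth_on S f \<Longrightarrow> smooth_on S (\<lambda>x. sqrt (f x))"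
  unfolding smooth_on_def by (blast intro: Ck_on_sqrt)

lemma smooth_on_compose_linear:
  assumes "open S" "bounded_linear h" "smooth_on T f" "h ` S \<subseteq> T"
  shows "smooth_on S (\<lambda>x. f (h x))"
  using assms unfolding smooth_on_def by (blast intro: Ck_on_compose_linear)

lemma smooth_on_has_derivative:
  assumes "smooth_on S f" "x \<in> S"
  shows "(f has_derivative frechet_derivative f (at x)) (at x)"
proof -
  have "Ck_on (Suc 0) S f"
    using assms(1) unfolding smooth_on_def by blast
  then show ?thesis
    using assms(2) by (simp add: frechet_derivative_works)
qed

section \<open>Inner products in coordinates\<close>

lemma bilinear_basis_expansion:
  fixes B :: "'e::euclidean_space \<Rightarrow> 'e \<Rightarrow> real"
  assumes "bilinear B"
  shows "B x y = (\<Sum>i\<in>Basis. \<Sum>j\<in>Basis. B i j * (x \<bullet> i) * (y \<bullet> j))"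
proof -
  have "B x y = B (\<Sum>i\<in>Basis. (x \<bullet> i) *\<^sub>R i) (\<Sum>j\<in>Basis. (y \<bullet> j) *\<^sub>R j)"
    by (simp add: euclidean_representation)
  also have "\<dots> = (\<Sum>i\<in>Basis. \<Sum>j\<in>Basis. B i j * (x \<bullet> i) * (y \<bullet> j))"
    by (simp add: bilinear_sum[OF assms] bilinear_lmul[OF assms] bilinear_rmul[OF assms]
        sum.cartesian_product algebra_simps)
  finally show ?thesis .
qed

text \<open>
  A matrix only has meaningful entries at pairs of basis vectors, but the matrices here are
  restrictions of bilinear forms, for which symmetry and positivity are statements about all
  vectors and need no sums.
\<close>
lemma pos_def_matrix_bilinear_iff:
  fixes B :: "'e::euclidean_space \<Rightarrow> 'e \<Rightarrow> real"
  assumes "bilinear B"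
  shows "pos_def_matrix B \<longleftrightarrow> (\<forall>x y. B x y = B y x) \<and> (\<forall>y. y \<noteq> 0 \<longrightarrow> B y y > 0)"
proof -
  have "B x y = B y x" if "\<forall>i\<in>Basis. \<forall>j\<in>Basis. B i j = B j i" for x y
  proof -
    have "B x y = (\<Sum>i\<in>Basis. \<Sum>j\<in>Basis. B i j * (x \<bullet> i) * (y \<bullet> j))"
      by (rule bilinear_basis_expansion[OF assms])
    also have "\<dots> = (\<Sum>i\<in>Basis. \<Sum>j\<in>Basis. B j i * (y \<bullet> j) * (x \<bullet> i))"
      using that by (intro sum.cong refl) (simp add: mult_ac)
    also have "\<dots> = B y x"
      by (subst sum.swap) (rule bilinear_basis_expansion[OF assms, symmetric])
    finally show ?thesis .
  qed
  then show ?thesis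
    unfolding pos_def_matrix_def bilinear_basis_expansion[OF assms, symmetric] by blast
qed

lemma bilinear_direct_sum:
  fixes B1 :: "'e::real_vector \<Rightarrow> 'e \<Rightarrow> real" and B2 :: "'f::real_vector \<Rightarrow> 'f \<Rightarrow> real"
  assumes "bilinear B1" "bilinear B2"
  shows "bilinear (\<lambda>y z. r * B1 (fst y) (fst z) + s * B2 (snd y) (snd z))"
  using assms unfolding bilinear_def linear_iff by (simp add: algebra_simps)

text \<open>
  The Hessian matrix of a Finslerian metric that comes from an inner product is that inner
  product.
\<close>
lemma half_second_partial_of_quadratic_form:
  fixes B :: "'e::euclidean_space \<Rightarrow> 'e \<Rightarrow> real"
  assumes B: "bilinear B" and sym: "\<And>x y. B x y = B y x"
  shows "(1/2) * partial i (\<lambda>z. partial j (\<lambda>w. B w w) z) y = B i j"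
proof -
  have bB: "bounded_bilinear B"
    using B by (simp add: bilinear_conv_bounded_bilinear)
  have "((\<lambda>w. B w w) has_derivative (\<lambda>h. B z h + B h z)) (at z)" for z
    using bounded_bilinear.FDERIV[OF bB has_derivative_ident has_derivative_ident] .
  from frechet_derivative_at[OF this] have "partial j (\<lambda>w. B w w) z = 2 * B z j" for z
    unfolding partial_def by (metis sym mult_2)
  moreover have D: "((\<lambda>z. 2 * B z j) has_derivative (\<lambda>h. 2 * B h j)) (at y)"
    by (intro bounded_linear_imp_has_derivative bounded_linear_const_mult
        bounded_bilinear.bounded_linear_left[OF bB])
  ultimately show ?thesis
    unfolding partial_def by (simp flip: frechet_derivative_at[OF D])
qed

section \<open>Randers norms on the plane\<close>

text \<open>
  The identity is only available off the axes, as on the slit tangent bundle of a product. Both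
  sides are continuous in \<open>t\<close>, so it extends to \<open>t = 0\<close>, where it becomes
  \<open>\<surd>A |s| + l s = |s| q + s lam\<close>; the signs \<open>s = \<plusminus>1\<close> separate the even from the odd part.
\<close>
lemma sqrt_binary_form_axis:
  fixes A B C l m q p lam mu :: real
  assumes lam: "\<bar>lam\<bar> \<le> q"
    and eq: "\<And>s t. s \<noteq> 0 \<Longrightarrow> t \<noteq> 0 \<Longrightarrow>
      sqrt (A * s\<^sup>2 + 2 * B * s * t + C * t\<^sup>2) + (l * s + m * t) =
      sqrt ((\<bar>s\<bar> * q + s * lam)\<^sup>2 + (\<bar>t\<bar> * p + t * mu)\<^sup>2)"
  shows "sqrt A = q" "l = lam"
proof -
  have lim: "sqrt (A * s\<^sup>2) + l * s = \<bar>s\<bar> * q + s * lam" if s: "s \<noteq> 0" for s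
  proof -
    let ?L = "\<lambda>t. sqrt (A * s\<^sup>2 + 2 * B * s * t + C * t\<^sup>2) + (l * s + m * t)"
    let ?R = "\<lambda>t. sqrt ((\<bar>s\<bar> * q + s * lam)\<^sup>2 + (\<bar>t\<bar> * p + t * mu)\<^sup>2)"
    have "isCont ?L 0" "isCont ?R 0"
      by (intro continuous_intros)+
    then have "(?L \<longlongrightarrow> ?L 0) (at 0)" "(?R \<longlongrightarrow> ?R 0) (at 0)"
      by (simp_all only: isCont_def)
    moreover have "\<forall>\<^sub>F t in at 0. ?L t = ?R t"
      using eq[OF s] by (auto simp: eventually_at_filter)
    ultimately have "(?R \<longlongrightarrow> ?L 0) (at 0)" "(?R \<longlongrightarrow> ?R 0) (at 0)"
      by (blast intro: Lim_transform_eventually)+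
    then have "?L 0 = ?R 0"
      by (rule tendsto_unique[OF trivial_limit_at])
    moreover have "\<bar>s\<bar> * q + s * lam \<ge> 0"
    proof -
      have "\<bar>s * lam\<bar> \<le> \<bar>s\<bar> * q"
        using lam by (simp add: abs_mult mult_left_mono)
      then show ?thesis by linarith
    qed
    ultimately show ?thesis
      by simp
  qed
  show "sqrt A = q" "l = lam"
    using lim[of 1] lim[of "-1"] by simp_all
qed

text \<open>
  The restrictions to the axes give \<open>A = q\<^sup>2\<close>, \<open>C = p\<^sup>2\<close>, \<open>l = lam\<close>, \<open>m = mu\<close>. Squaring
  the identity at \<open>(1, t)\<close> and \<open>(-1, -t)\<close> and adding forces \<open>B = - lam mu\<close>, while
  subtracting gives \<open>\<surd>Q(1,t) (lam + mu t) = q lam + |t| t p mu\<close>. The squares of this relation at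
  \<open>t\<close> and \<open>-t\<close> differ by a multiple of
  \<open>lam mu (q\<^sup>2 - lam\<^sup>2 + (p\<^sup>2 - mu\<^sup>2) t\<^sup>2 - q p t)\<close>. If \<open>lam mu\<close> were nonzero, the second factor
  would be a polynomial vanishing for all \<open>t > 0\<close>, against \<open>q p > 0\<close>. Once one of the two
  coefficients is zero, the squared relation at \<open>t = 1\<close> kills the other.
\<close>
lemma binary_randers_norm_forms_vanish:
  fixes A B C l m q p lam mu :: real
  assumes q: "q > 0" "\<bar>lam\<bar> \<le> q" and p: "p > 0" "\<bar>mu\<bar> \<le> p"
    and nonneg: "\<And>s t. A * s\<^sup>2 + 2 * B * s * t + C * t\<^sup>2 \<ge> 0"
    and eq: "\<And>s t. s \<noteq> 0 \<Longrightarrow> t \<noteq> 0 \<Longrightarrow>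
      sqrt (A * s\<^sup>2 + 2 * B * s * t + C * t\<^sup>2) + (l * s + m * t) =
      sqrt ((\<bar>s\<bar> * q + s * lam)\<^sup>2 + (\<bar>t\<bar> * p + t * mu)\<^sup>2)"
  shows "lam = 0" "mu = 0"
proof -
  have eq': "sqrt (C * s\<^sup>2 + 2 * B * s * t + A * t\<^sup>2) + (m * s + l * t) =
      sqrt ((\<bar>s\<bar> * p + s * mu)\<^sup>2 + (\<bar>t\<bar> * q + t * lam)\<^sup>2)"
    if "s \<noteq> 0" "t \<noteq> 0" for s t
    using eq[of t s] that by (simp add: add_ac mult_ac)
  have "sqrt A = q" and l: "l = lam"
    using sqrt_binary_form_axis[OF q(2) eq] by blast+
  moreover have "sqrt C = p" and m: "m = mu"
    using sqrt_binary_form_axis[of mu p C B A m l q lam, OF p(2) eq'] by blast+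
  ultimately have A: "A = q\<^sup>2" and C: "C = p\<^sup>2"
    using q p by auto
  define Q where "Q t = q\<^sup>2 + 2 * B * t + p\<^sup>2 * t\<^sup>2" for t
  have Q: "Q t \<ge> 0" for t
    using nonneg[of 1 t] by (simp add: Q_def A C)
  \<comment> \<open>the even and the odd part of the squared identity under \<open>(s, t) \<mapsto> (-s, -t)\<close>\<close>
  have sum_diff: "Q t + (lam + mu * t)\<^sup>2 = q\<^sup>2 + lam\<^sup>2 + t\<^sup>2 * (p\<^sup>2 + mu\<^sup>2)"
    "sqrt (Q t) * (lam + mu * t) = q * lam + \<bar>t\<bar> * t * p * mu" if "t \<noteq> 0" for t
  proof -
    have "sqrt (Q t) + (lam + mu * t) = sqrt ((q + lam)\<^sup>2 + (\<bar>t\<bar> * p + t * mu)\<^sup>2)"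
      using eq[of 1 t] that by (simp add: Q_def A C l m)
    then have plus: "(sqrt (Q t) + (lam + mu * t))\<^sup>2 = (q + lam)\<^sup>2 + (\<bar>t\<bar> * p + t * mu)\<^sup>2"
      by simp
    have "sqrt (Q t) - (lam + mu * t) = sqrt ((q - lam)\<^sup>2 + (\<bar>t\<bar> * p - t * mu)\<^sup>2)"
      using eq[of "-1" "-t"] that by (simp add: Q_def A C l m)
    then have minus: "(sqrt (Q t) - (lam + mu * t))\<^sup>2 = (q - lam)\<^sup>2 + (\<bar>t\<bar> * p - t * mu)\<^sup>2"
      by simp
    show "Q t + (lam + mu * t)\<^sup>2 = q\<^sup>2 + lam\<^sup>2 + t\<^sup>2 * (p\<^sup>2 + mu\<^sup>2)"
      using plus minus Q[of t] by (simp add: power2_sum power2_diff power_mult_distrib algebra_simps)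
    show "sqrt (Q t) * (lam + mu * t) = q * lam + \<bar>t\<bar> * t * p * mu"
      using plus minus by (simp add: power2_sum power2_diff algebra_simps)
  qed
  have B: "B = - (lam * mu)"
    using sum_diff(1)[of 1] by (simp add: Q_def power2_sum)
  have sq: "Q t * (lam + mu * t)\<^sup>2 = (q * lam + \<bar>t\<bar> * t * p * mu)\<^sup>2" if "t \<noteq> 0" for t
    using arg_cong[OF sum_diff(2)[OF that], of "\<lambda>x. x\<^sup>2"] Q[of t] by (simp add: power_mult_distrib)
  have dich: "lam * mu = 0 \<or> q\<^sup>2 - lam\<^sup>2 + (p\<^sup>2 - mu\<^sup>2) * t\<^sup>2 = q * p * t" if t: "t > 0" for t
  proof -
    have "(q\<^sup>2 - 2 * (lam * mu) * t + p\<^sup>2 * t\<^sup>2) * (lam + mu * t)\<^sup>2 = (q * lam + t * t * p * mu)\<^sup>2"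
      using sq[of t] t by (simp add: Q_def B)
    moreover have "(q\<^sup>2 + 2 * (lam * mu) * t + p\<^sup>2 * t\<^sup>2) * (lam - mu * t)\<^sup>2 = (q * lam - t * t * p * mu)\<^sup>2"
      using sq[of "-t"] t by (simp add: Q_def B)
    moreover have "4 * t * (lam * mu * (q\<^sup>2 - lam\<^sup>2 + (p\<^sup>2 - mu\<^sup>2) * t\<^sup>2 - q * p * t)) =
        ((q\<^sup>2 - 2 * (lam * mu) * t + p\<^sup>2 * t\<^sup>2) * (lam + mu * t)\<^sup>2 - (q * lam + t * t * p * mu)\<^sup>2)
        - ((q\<^sup>2 + 2 * (lam * mu) * t + p\<^sup>2 * t\<^sup>2) * (lam - mu * t)\<^sup>2 - (q * lam - t * t * p * mu)\<^sup>2)"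
      by (simp add: power2_eq_square algebra_simps)
    ultimately have "4 * t * (lam * mu * (q\<^sup>2 - lam\<^sup>2 + (p\<^sup>2 - mu\<^sup>2) * t\<^sup>2 - q * p * t)) = 0"
      by simp
    then show ?thesis
      using t by simp
  qed
  have "lam * mu = 0"
  proof (rule ccontr)
    assume "lam * mu \<noteq> 0"
    \<comment> \<open>three values of \<open>t\<close> determine a quadratic polynomial\<close>
    then have "q\<^sup>2 - lam\<^sup>2 + (p\<^sup>2 - mu\<^sup>2) = q * p"
        "q\<^sup>2 - lam\<^sup>2 + (p\<^sup>2 - mu\<^sup>2) * 4 = q * p * 2"
        "q\<^sup>2 - lam\<^sup>2 + (p\<^sup>2 - mu\<^sup>2) * 9 = q * p * 3"
      using dich[of 1] dich[of 2] dich[of 3] by simp_all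
    moreover have "z = 0" if "x + y = z" "x + y * 4 = z * 2" "x + y * 9 = z * 3" for x y z :: real
      using that by linarith
    ultimately have "q * p = 0"
      by blast
    then show False
      using q p by simp
  qed
  moreover have "mu = 0" if "lam = 0"
    using sq[of 1] that q by (simp add: Q_def B algebra_simps power_mult_distrib)
  moreover have "lam = 0" if "mu = 0"
    using sq[of 1] that p by (simp add: Q_def B algebra_simps power_mult_distrib)
  ultimately show "lam = 0" "mu = 0"
    by auto
qed

section \<open>Tangent vectors in coordinates\<close>

abbreviation transition_deriv ::
  "('a, 'e::euclidean_space) chart \<Rightarrow> ('a, 'e) chart \<Rightarrow> 'a \<Rightarrow> 'e \<Rightarrow> 'e" where
  "transition_deriv c d p \<equiv> frechet_derivative (snd d \<circ> chart_inv c) (at (snd c p))"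

lemma chart_inv_chart:
  assumes "smooth_manifold M A" "c \<in> A" "p \<in> fst c"
  shows "chart_inv c (snd c p) = p"
  using chart_inj[OF assms(1,2)] assms(3) by (simp add: chart_inv_def)

lemma transition_has_derivative:
  assumes "smooth_manifold M A" "c \<in> A" "d \<in> A" "p \<in> fst c" "p \<in> fst d"
  shows "((snd d \<circ> chart_inv c) has_derivative transition_deriv c d p) (at (snd c p))"
  by (rule smooth_on_has_derivative[OF transition_smooth[OF assms(1-3)]]) (use assms in auto)

lemma linear_transition_deriv:
  assumes "smooth_manifold M A" "c \<in> A" "d \<in> A" "p \<in> fst c" "p \<in> fst d"
  shows "linear (transition_deriv c d p)"
  using transition_has_derivative[OF assms] has_derivative_linear by blast

lemma transition_deriv_self:
  assumes "smooth_manifold M A" "c \<in> A" "p \<in> fst c"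
  shows "transition_deriv c c p y = y"
proof -
  have "((snd c \<circ> chart_inv c) has_derivative (\<lambda>y. y)) (at (snd c p))"
    by (rule has_derivative_transform_within_open[OF has_derivative_ident chart_props(2)[OF assms(1,2)]])
      (use assms chart_inv_chart[OF assms(1,2)] in auto)
  then show ?thesis
    by (simp flip: frechet_derivative_at)
qed

text \<open>
  The chain rule for transition maps. It makes the coordinate vectors of \<open>of_coords\<close> in different
  charts compatible, so that they form a tangent vector.
\<close>
lemma transition_deriv_cocycle:
  assumes M: "smooth_manifold M A" and A: "c \<in> A" "d \<in> A" "e \<in> A"
    and p: "p \<in> fst c" "p \<in> fst d" "p \<in> fst e"
  shows "transition_deriv d e p (transition_deriv c d p y) = transition_deriv c e p y"
proof -
  have inv: "(snd d \<circ> chart_inv c) (snd c p) = snd d p"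
    using chart_inv_chart[OF M A(1) p(1)] by simp
  have "((snd e \<circ> chart_inv d) \<circ> (snd d \<circ> chart_inv c) has_derivative
      transition_deriv d e p \<circ> transition_deriv c d p) (at (snd c p))"
    by (rule diff_chain_at[OF transition_has_derivative[OF M A(1,2) p(1,2)]])
      (unfold inv, rule transition_has_derivative[OF M A(2,3) p(2,3)])
  then have "((snd e \<circ> chart_inv c) has_derivative
      transition_deriv d e p \<circ> transition_deriv c d p) (at (snd c p))"
    by (rule has_derivative_transform_within_open[OF _ open_overlap[OF M A(1,2)]])
      (use p chart_inv_chart[OF M A(1)] chart_inv_chart[OF M A(2)] in auto)
  then show ?thesis
    by (simp flip: frechet_derivative_at)
qed

lemma chart_at_props:
  assumes "p \<in> (\<Union>c\<in>A. fst c)"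
  shows "chart_at A p \<in> A" "p \<in> fst (chart_at A p)"
proof -
  have "\<exists>c. c \<in> A \<and> p \<in> fst c"
    using assms by auto
  from someI_ex[OF this] show "chart_at A p \<in> A" "p \<in> fst (chart_at A p)"
    by (simp_all add: chart_at_def)
qed

lemma of_coords_in_tangent_space:
  assumes "smooth_manifold M A" "c \<in> A" "p \<in> fst c"
  shows "of_coords A c p y \<in> tangent_space A p"
  using assms transition_deriv_cocycle[OF assms(1,2) _ _ assms(3)]
  by (auto simp: tangent_space_def of_coords_def)

lemma of_coords_apply:
  assumes "smooth_manifold M A" "c \<in> A" "p \<in> fst c"
  shows "of_coords A c p y c = y"
  using assms transition_deriv_self[OF assms] by (simp add: of_coords_def)

lemma of_coords_of_tangent:
  assumes "c \<in> A" "p \<in> fst c" "v \<in> tangent_space A p"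
  shows "of_coords A c p (v c) = v"
proof
  fix d
  note v = assms(3)[unfolded tangent_space_def mem_Collect_eq]
  show "of_coords A c p (v c) d = v d"
  proof (cases "d \<in> A \<and> p \<in> fst d")
    case True
    then have "v d = transition_deriv c d p (v c)"
      by (intro v[THEN conjunct1, rule_format]) (use assms(1,2) in auto)
    with True show ?thesis
      unfolding of_coords_def by (simp only: simp_thms if_True)
  next
    case False
    then have "v d = 0"
      by (intro v[THEN conjunct2, rule_format]) auto
    with False show ?thesis
      unfolding of_coords_def by (simp only: if_False)
  qed
qed

lemma of_coords_scaleR:
  assumes "smooth_manifold M A" "c \<in> A" "p \<in> fst c"
  shows "of_coords A c p (r *\<^sub>R y) = (\<lambda>d. r *\<^sub>R of_coords A c p y d)"
  using linear_scale[OF linear_transition_deriv[OF assms(1,2) _ assms(3)]]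
  by (auto simp: of_coords_def fun_eq_iff)

lemma of_coords_eq_0_iff:
  assumes "smooth_manifold M A" "c \<in> A" "p \<in> fst c"
  shows "of_coords A c p y = (\<lambda>_. 0) \<longleftrightarrow> y = 0"
proof
  assume "of_coords A c p y = (\<lambda>_. 0)"
  then show "y = 0"
    using of_coords_apply[OF assms, of y] by simp
next
  assume "y = 0"
  then show "of_coords A c p y = (\<lambda>_. 0)"
    using of_coords_scaleR[OF assms, of 0 y] by simp
qed

lemma of_coords_in_slit_bundle_iff:
  assumes "smooth_manifold M A" "c \<in> A" "p \<in> fst c"
  shows "(p, of_coords A c p y) \<in> slit_bundle A \<longleftrightarrow> y \<noteq> 0"
  using assms of_coords_eq_0_iff[OF assms] of_coords_in_tangent_space[OF assms]
  by (auto simp: slit_bundle_def tangent_bundle_def)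

lemma prod_atlasE:
  assumes "e \<in> prod_atlas A1 A2"
  obtains c d where "e = prod_chart c d" "c \<in> A1" "d \<in> A2"
  using assms by (auto simp: prod_atlas_def)

lemma prod_chart_in_prod_atlas: "c \<in> A1 \<Longrightarrow> d \<in> A2 \<Longrightarrow> prod_chart c d \<in> prod_atlas A1 A2"
  unfolding prod_atlas_def by blast

lemma fst_prod_chart [simp]: "fst (prod_chart c d) = fst c \<times> fst d"
  and snd_prod_chart [simp]: "snd (prod_chart c d) p = (snd c (fst p), snd d (snd p))"
  by (simp_all add: prod_chart_def map_prod_def case_prod_unfold)

lemma prod_chart_image: "snd (prod_chart c d) ` fst (prod_chart c d) = snd c ` fst c \<times> snd d ` fst d"
  unfolding prod_chart_def fst_conv snd_conv map_prod_surj_on[OF refl refl] ..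

lemma prod_atlas_domain: "(\<Union>e\<in>prod_atlas A1 A2. fst e) = (\<Union>c\<in>A1. fst c) \<times> (\<Union>d\<in>A2. fst d)"
proof -
  have "prod_atlas A1 A2 = (\<Union>c\<in>A1. \<Union>d\<in>A2. {prod_chart c d})"
    unfolding prod_atlas_def by blast
  then show ?thesis by auto
qed

context
  fixes M1 :: "'a topology" and A1 :: "('a, 'e::euclidean_space) chart set"
    and M2 :: "'b topology" and A2 :: "('b, 'f::euclidean_space) chart set"
  assumes M1: "smooth_manifold M1 A1" and M2: "smooth_manifold M2 A2"
begin

text \<open>
  The differentials of the projections are defined through a chosen chart at \<open>p\<close>, which need not
  be \<open>prod_chart c d\<close>. In the target chart \<open>c\<close> the first projection is the first component of the
  product chart, so its differential is the first component of a transition derivative, and that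
  takes the coordinates of \<open>v\<close> in the chosen chart to those in \<open>prod_chart c d\<close>.
\<close>
lemma dfst_dsnd_apply:
  assumes v: "v \<in> tangent_space (prod_atlas A1 A2) p"
    and c: "c \<in> A1" "fst p \<in> fst c" and d: "d \<in> A2" "snd p \<in> fst d"
  shows "dfst A1 A2 p v c = fst (v (prod_chart c d))"
    and "dsnd A1 A2 p v d = snd (v (prod_chart c d))"
proof -
  let ?e = "prod_chart c d" and ?P = "prod_atlas A1 A2"
  let ?e' = "chart_at ?P p"
  have e: "?e \<in> ?P" "p \<in> fst ?e"
    using c d by (auto intro: prod_chart_in_prod_atlas simp: mem_Times_iff)
  then have e': "?e' \<in> ?P" "p \<in> fst ?e'"
    using chart_at_props[of p ?P] by blast+
  have D: "((snd ?e \<circ> chart_inv ?e') has_derivative transition_deriv ?e' ?e p) (at (snd ?e' p))"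
    using transition_has_derivative[OF smooth_manifold_prod[OF M1 M2] e'(1) e(1) e'(2) e(2)] .
  have v_e: "v ?e = transition_deriv ?e' ?e p (v ?e')"
    using v e e' unfolding tangent_space_def by blast
  have "(snd c \<circ> fst \<circ> chart_inv ?e' has_derivative (\<lambda>y. fst (transition_deriv ?e' ?e p y))) (at (snd ?e' p))"
    using has_derivative_fst[OF D] by (simp add: comp_def)
  from fun_cong[OF frechet_derivative_at[OF this], of "v ?e'"]
  show "dfst A1 A2 p v c = fst (v ?e)"
    using c by (simp add: differential_def Let_def v_e)
  have "(snd d \<circ> snd \<circ> chart_inv ?e' has_derivative (\<lambda>y. snd (transition_deriv ?e' ?e p y))) (at (snd ?e' p))"
    using has_derivative_snd[OF D] by (simp add: comp_def)
  from fun_cong[OF frechet_derivative_at[OF this], of "v ?e'"]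
  show "dsnd A1 A2 p v d = snd (v ?e)"
    using d by (simp add: differential_def Let_def v_e)
qed

lemma transition_deriv_prod_chart:
  assumes c: "c \<in> A1" "c' \<in> A1" "x1 \<in> fst c" "x1 \<in> fst c'"
    and d: "d \<in> A2" "d' \<in> A2" "x2 \<in> fst d" "x2 \<in> fst d'"
  shows "transition_deriv (prod_chart c d) (prod_chart c' d') (x1, x2) y =
    (transition_deriv c c' x1 (fst y), transition_deriv d d' x2 (snd y))"
proof -
  let ?z = "(snd c x1, snd d x2)"
  have p: "(fst has_derivative fst) (at ?z)" "(snd has_derivative snd) (at ?z)"
    by (simp_all add: bounded_linear_imp_has_derivative bounded_linear_fst bounded_linear_snd)
  have t: "((snd c' \<circ> chart_inv c) has_derivative transition_deriv c c' x1) (at (fst ?z))"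
    "((snd d' \<circ> chart_inv d) has_derivative transition_deriv d d' x2) (at (snd ?z))"
    using transition_has_derivative[OF M1 c] transition_has_derivative[OF M2 d] by simp_all
  have D: "((\<lambda>z. ((snd c' \<circ> chart_inv c) (fst z), (snd d' \<circ> chart_inv d) (snd z))) has_derivative
      (\<lambda>y. (transition_deriv c c' x1 (fst y), transition_deriv d d' x2 (snd y)))) (at ?z)"
    using has_derivative_Pair[OF diff_chain_at[OF p(1) t(1)] diff_chain_at[OF p(2) t(2)]]
    by (simp add: comp_def)
  have "((snd (prod_chart c' d') \<circ> chart_inv (prod_chart c d)) has_derivative
      (\<lambda>y. (transition_deriv c c' x1 (fst y), transition_deriv d d' x2 (snd y)))) (at ?z)"
    by (rule has_derivative_transform_within_open[OF D open_Times[OF chart_props(2)[OF M1 c(1)] chart_props(2)[OF M2 d(1)]]])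
      (use c d chart_inv_prod_chart[OF chart_inj[OF M1 c(1)] chart_inj[OF M2 d(1)]] in auto)
  then show ?thesis
    by (simp flip: frechet_derivative_at)
qed

text \<open>
  With this, functions on the tangent bundle of the product that are built from the two
  differentials can be computed in product coordinates.
\<close>
lemma dfst_dsnd_of_coords:
  assumes c: "c \<in> A1" "x1 \<in> fst c" and d: "d \<in> A2" "x2 \<in> fst d"
  defines "P \<equiv> prod_atlas A1 A2"
  shows "dfst A1 A2 (x1, x2) (of_coords P (prod_chart c d) (x1, x2) y) = of_coords A1 c x1 (fst y)"
    and "dsnd A1 A2 (x1, x2) (of_coords P (prod_chart c d) (x1, x2) y) = of_coords A2 d x2 (snd y)"
proof -
  have e: "prod_chart c d \<in> P" "(x1, x2) \<in> fst (prod_chart c d)"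
    using c d by (auto simp: P_def intro: prod_chart_in_prod_atlas)
  let ?w = "of_coords P (prod_chart c d) (x1, x2) y"
  have w: "?w \<in> tangent_space P (x1, x2)"
    using of_coords_in_tangent_space[OF smooth_manifold_prod[OF M1 M2]] e unfolding P_def by blast
  have w_e: "?w (prod_chart c' d') = (transition_deriv c c' x1 (fst y), transition_deriv d d' x2 (snd y))"
    if "c' \<in> A1" "x1 \<in> fst c'" "d' \<in> A2" "x2 \<in> fst d'" for c' d'
    using transition_deriv_prod_chart[OF c(1) that(1) c(2) that(2) d(1) that(3) d(2) that(4)]
      prod_chart_in_prod_atlas[OF that(1,3)] that unfolding of_coords_def P_def by simp
  show "dfst A1 A2 (x1, x2) ?w = of_coords A1 c x1 (fst y)"
  proof
    fix c'
    show "dfst A1 A2 (x1, x2) ?w c' = of_coords A1 c x1 (fst y) c'"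
    proof (cases "c' \<in> A1 \<and> x1 \<in> fst c'")
      case True
      then show ?thesis
        using dfst_dsnd_apply(1)[OF w[unfolded P_def], of c' d] w_e[of c' d] d
        by (simp add: of_coords_def[of A1] P_def)
    qed (auto simp: differential_def of_coords_def[of A1])
  qed
  show "dsnd A1 A2 (x1, x2) ?w = of_coords A2 d x2 (snd y)"
  proof
    fix d'
    show "dsnd A1 A2 (x1, x2) ?w d' = of_coords A2 d x2 (snd y) d'"
    proof (cases "d' \<in> A2 \<and> x2 \<in> fst d'")
      case True
      then show ?thesis
        using dfst_dsnd_apply(2)[OF w[unfolded P_def], of c d'] w_e[of c d'] c
        by (simp add: of_coords_def[of A2] P_def)
    qed (auto simp: differential_def of_coords_def[of A2])
  qed
qed

lemma of_coords_in_slit_prod_bundle_iff: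
  assumes c: "c \<in> A1" "x1 \<in> fst c" and d: "d \<in> A2" "x2 \<in> fst d"
  shows "((x1, x2), of_coords (prod_atlas A1 A2) (prod_chart c d) (x1, x2) y) \<in> slit_prod_bundle A1 A2
    \<longleftrightarrow> fst y \<noteq> 0 \<and> snd y \<noteq> 0"
proof -
  have "prod_chart c d \<in> prod_atlas A1 A2" "(x1, x2) \<in> fst (prod_chart c d)"
    using c d by (auto intro: prod_chart_in_prod_atlas)
  then have "((x1, x2), of_coords (prod_atlas A1 A2) (prod_chart c d) (x1, x2) y)
      \<in> tangent_bundle (prod_atlas A1 A2)"
    using of_coords_in_tangent_space[OF smooth_manifold_prod[OF M1 M2]]
    unfolding tangent_bundle_def by blast
  then show ?thesis
    using of_coords_eq_0_iff[OF M1 c, of "fst y"] of_coords_eq_0_iff[OF M2 d, of "snd y"]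
      dfst_dsnd_of_coords[OF c d, of y]
    by (simp add: slit_prod_bundle_def)
qed

text \<open>
  Reduces statements about vectors tangent to the product to vectors given by coordinates in a
  product chart.
\<close>
lemma prod_tangent_vectorE:
  assumes "(p, v) \<in> tangent_bundle (prod_atlas A1 A2)"
  obtains c d x1 x2 y where "p = (x1, x2)" "c \<in> A1" "x1 \<in> fst c" "d \<in> A2" "x2 \<in> fst d"
    "v = of_coords (prod_atlas A1 A2) (prod_chart c d) (x1, x2) y"
proof -
  obtain e where "e \<in> prod_atlas A1 A2" "p \<in> fst e" and v: "v \<in> tangent_space (prod_atlas A1 A2) p"
    using assms by (auto simp: tangent_bundle_def)
  moreover from this obtain c d where "e = prod_chart c d" "c \<in> A1" "d \<in> A2"
    by (rule_tac prod_atlasE)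
  moreover obtain x1 x2 where "p = (x1, x2)"
    by fastforce
  ultimately show ?thesis
    using of_coords_of_tangent[of e "prod_atlas A1 A2" p v] that[of x1 x2 c d "v e"] by auto
qed

end

section \<open>Randers metrics in coordinates\<close>

lemma riemannian_metric_props:
  assumes "riemannian_metric A a" "c \<in> A" "p \<in> fst c"
  shows "bilinear (\<lambda>y z. a p (of_coords A c p y) (of_coords A c p z))"
    and "a p (of_coords A c p y) (of_coords A c p z) = a p (of_coords A c p z) (of_coords A c p y)"
    and "y \<noteq> 0 \<Longrightarrow> a p (of_coords A c p y) (of_coords A c p y) > 0"
    and "a p (of_coords A c p y) (of_coords A c p y) \<ge> 0"
proof -
  show b: "bilinear (\<lambda>y z. a p (of_coords A c p y) (of_coords A c p z))"
    using assms unfolding riemannian_metric_def by blast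
  have "pos_def_matrix (\<lambda>y z. a p (of_coords A c p y) (of_coords A c p z))"
    using assms unfolding riemannian_metric_def by blast
  then show "a p (of_coords A c p y) (of_coords A c p z) = a p (of_coords A c p z) (of_coords A c p y)"
    and pos: "y \<noteq> 0 \<Longrightarrow> a p (of_coords A c p y) (of_coords A c p y) > 0"
    unfolding pos_def_matrix_bilinear_iff[OF b] by blast+
  show "a p (of_coords A c p y) (of_coords A c p y) \<ge> 0"
    using pos bilinear_lzero[OF b, of 0] by (cases "y = 0") (simp_all add: less_imp_le)
qed

lemma riem_norm_scaleR:
  assumes "riemannian_metric A a" "c \<in> A" "p \<in> fst c"
  shows "riem_norm a p (of_coords A c p (s *\<^sub>R y)) = \<bar>s\<bar> * riem_norm a p (of_coords A c p y)"
proof -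
  note b = riemannian_metric_props(1)[OF assms]
  show ?thesis
    using bilinear_lmul[OF b, of s y "s *\<^sub>R y"] bilinear_rmul[OF b, of y s y]
    by (simp add: riem_norm_def real_sqrt_mult flip: mult.assoc)
qed

lemma finsler_metric_smooth:
  assumes "finsler_metric A S F" "c \<in> A"
  shows "smooth_on {(x, y). x \<in> snd c ` fst c \<and> (chart_inv c x, of_coords A c (chart_inv c x) y) \<in> S}
    (\<lambda>(x, y). F (chart_inv c x) (of_coords A c (chart_inv c x) y))"
proof -
  have "\<forall>c\<in>A. smooth_on
      {(x, y). x \<in> snd c ` fst c \<and> (chart_inv c x, of_coords A c (chart_inv c x) y) \<in> S}
      (\<lambda>(x, y). F (chart_inv c x) (of_coords A c (chart_inv c x) y))"
    using assms(1) unfolding finsler_metric_def by - (elim conjE, assumption)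
  then show ?thesis
    using assms(2) by (rule bspec)
qed

lemma one_form_linear:
  assumes "one_form A b" "c \<in> A" "p \<in> fst c"
  shows "linear (\<lambda>y. b p (of_coords A c p y))"
  using assms unfolding one_form_def by blast

text \<open>
  The decomposition \<open>F = \<alpha> + \<beta>\<close> is given off the zero section only. On the zero section,
  positive homogeneity forces \<open>F = 0\<close>.
\<close>
lemma randers_with_coords:
  assumes M: "smooth_manifold M A" and R: "randers_with A (slit_bundle A) a b F"
    and c: "c \<in> A" "p \<in> fst c"
  shows "y \<noteq> 0 \<Longrightarrow> F p (of_coords A c p y) = riem_norm a p (of_coords A c p y) + b p (of_coords A c p y)"
    and "F p (of_coords A c p y) \<ge> 0"
    and "r > 0 \<Longrightarrow> F p (of_coords A c p (r *\<^sub>R y)) = r * F p (of_coords A c p y)"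
    and "F p (of_coords A c p 0) = 0"
proof -
  have t: "(p, of_coords A c p y) \<in> tangent_bundle A" for y
    using of_coords_in_tangent_space[OF M c] c by (auto simp: tangent_bundle_def)
  have nonneg: "\<forall>(p, v)\<in>tangent_bundle A. F p v \<ge> 0"
    and homogeneous: "\<forall>(p, v)\<in>tangent_bundle A. \<forall>r>0. F p (\<lambda>c. r *\<^sub>R v c) = r * F p v"
    and sum: "\<forall>(p, v)\<in>slit_bundle A. F p v = riem_norm a p v + b p v"
    using R unfolding randers_with_def finsler_metric_def by - (elim conjE, assumption)+
  show "F p (of_coords A c p y) \<ge> 0"
    using bspec[OF nonneg t] by simp
  show hom: "F p (of_coords A c p (r *\<^sub>R y)) = r * F p (of_coords A c p y)" if "r > 0" for r y
    using bspec[OF homogeneous t[of y]] that unfolding of_coords_scaleR[OF M c] by simp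
  show "F p (of_coords A c p 0) = 0"
    using hom[of 2 0] by simp
  show "F p (of_coords A c p y) = riem_norm a p (of_coords A c p y) + b p (of_coords A c p y)" if "y \<noteq> 0"
    using bspec[OF sum, of "(p, of_coords A c p y)"] that of_coords_in_slit_bundle_iff[OF M c, of y] by simp
qed

lemma randers_with_scaleR:
  assumes M: "smooth_manifold M A" and R: "randers_with A (slit_bundle A) a b F"
    and c: "c \<in> A" "p \<in> fst c" and y: "y \<noteq> 0" and s: "s \<noteq> 0"
  shows "F p (of_coords A c p (s *\<^sub>R y)) =
    \<bar>s\<bar> * riem_norm a p (of_coords A c p y) + s * b p (of_coords A c p y)"
proof -
  have "riemannian_metric A a" "one_form A b"
    using R unfolding randers_with_def by blast+
  then show ?thesis
    using riem_norm_scaleR[of A a c p s y] linear_scale[OF one_form_linear[of A b c p], of s y]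
      randers_with_coords(1)[OF M R c, of "s *\<^sub>R y"] c y s by simp
qed

text \<open>
  Holds for \<open>y = 0\<close> too, hence \<open>F\<^sup>2\<close> is a quadratic form on the entire tangent space. On a product
  this matters for vectors with one zero component.
\<close>
lemma randers_with_zero_form_square:
  assumes M: "smooth_manifold M A" and R: "randers_with A (slit_bundle A) a b F"
    and b: "\<And>x v. (x, v) \<in> slit_bundle A \<Longrightarrow> b x v = 0"
    and c: "c \<in> A" "p \<in> fst c"
  shows "(F p (of_coords A c p y))\<^sup>2 = a p (of_coords A c p y) (of_coords A c p y)"
proof -
  have a: "riemannian_metric A a"
    using R unfolding randers_with_def by blast
  show ?thesis
  proof (cases "y = 0")
    case True
    then show ?thesis
      using randers_with_coords(4)[OF M R c] bilinear_lzero[OF riemannian_metric_props(1)[OF a c]]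
      by simp
  next
    case False
    then have "b p (of_coords A c p y) = 0"
      using of_coords_in_slit_bundle_iff[OF M c] by (intro b) simp
    with False show ?thesis
      using randers_with_coords(1)[OF M R c, of y] riemannian_metric_props(3)[OF a c, of y]
      by (simp add: riem_norm_def)
  qed
qed

text \<open>
  The two signs come from \<open>F \<ge> 0\<close> at \<open>y\<close> and at \<open>-y\<close>.
\<close>
lemma abs_form_le_riem_norm:
  assumes M: "smooth_manifold M A" and R: "randers_with A (slit_bundle A) a b F"
    and c: "c \<in> A" "p \<in> fst c" and y: "y \<noteq> 0"
  shows "\<bar>b p (of_coords A c p y)\<bar> \<le> riem_norm a p (of_coords A c p y)"
  using randers_with_scaleR[OF M R c y, of 1] randers_with_scaleR[OF M R c y, of "-1"]
    randers_with_coords(2)[OF M R c, of "1 *\<^sub>R y"] randers_with_coords(2)[OF M R c, of "(-1) *\<^sub>R y"]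
  by simp

lemma one_form_zero: "one_form A (\<lambda>_ _. 0)"
  by (simp add: one_form_def linear_iff smooth_on_const)

lemma form_norm_zero: "form_norm A a (\<lambda>_ _. 0) p = 0"
  by (simp add: form_norm_def Let_def)

lemma randers_metric_empty:
  assumes "(\<Union>c\<in>A. fst c) = {}" "S \<subseteq> tangent_bundle A"
  shows "randers_metric A S F"
proof -
  have "fst c = {}" if "c \<in> A" for c
    using assms(1) that by blast
  moreover have "tangent_bundle A = {}" "S = {}"
    using assms by (auto simp: tangent_bundle_def)
  ultimately have "finsler_metric A S F" "riemannian_metric A (\<lambda>_ _ _. 0)"
    by (simp_all add: finsler_metric_def riemannian_metric_def smooth_on_empty)
  then show ?thesis
    unfolding randers_metric_def randers_with_def \<open>S = {}\<close>
    by (intro exI[of _ "\<lambda>_ _ _. 0"] exI[of _ "\<lambda>_ _. 0"]) (simp add: one_form_zero form_norm_zero)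
qed

text \<open>
  The zero vector is included because a basis vector of the product space has one zero component.
\<close>
lemma riemannian_metric_component_smooth:
  assumes M: "smooth_manifold M A" and a: "riemannian_metric A a" and c: "c \<in> A"
    and ij: "i \<in> insert 0 Basis" "j \<in> insert 0 Basis"
  shows "smooth_on (snd c ` fst c)
    (\<lambda>x. a (chart_inv c x) (of_coords A c (chart_inv c x) i) (of_coords A c (chart_inv c x) j))"
proof (cases "i = 0 \<or> j = 0")
  case True
  have "a (chart_inv c x) (of_coords A c (chart_inv c x) i) (of_coords A c (chart_inv c x) j) = 0"
    if "x \<in> snd c ` fst c" for x
  proof -
    have "chart_inv c x \<in> fst c"
      using that chart_inv_chart[OF M c] by auto
    from riemannian_metric_props(1)[OF a c this] show ?thesis
      using True bilinear_lzero bilinear_rzero by fastforce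
  qed
  then show ?thesis
    by (intro smooth_on_cong[OF chart_props(2)[OF M c] _ smooth_on_const[of _ 0]]) simp
next
  case False
  then show ?thesis
    using a c ij unfolding riemannian_metric_def by blast
qed

section \<open>The convolution as a doubly warped product\<close>

lemma gradient_of_constant:
  assumes M: "smooth_manifold M A" and c: "c \<in> A" "p \<in> fst c" and u: "\<forall>x\<in>topspace M. u x = k"
  shows "gradient A F u c p y j = 0"
proof -
  have dom: "fst c \<subseteq> topspace M"
    using chart_props(1)[OF M c(1)] by (rule openin_subset)
  have "((u \<circ> chart_inv c) has_derivative (\<lambda>_. 0)) (at (snd c p))"
    by (rule has_derivative_transform_within_open[OF has_derivative_const[of k] chart_props(2)[OF M c(1)]])
      (use c chart_inv_chart[OF M c(1)] u dom in auto)
  then have "partial i (u \<circ> chart_inv c) (snd c p) = 0" for i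
    unfolding partial_def by (simp flip: frechet_derivative_at)
  then show ?thesis
    by (simp add: gradient_def)
qed

text \<open>
  This is the convolution without its mixed term.
\<close>
definition doubly_warped_product ::
  "('a, 'e::euclidean_space) chart set \<Rightarrow> ('b, 'f::euclidean_space) chart set \<Rightarrow>
   ('a \<Rightarrow> ('a, 'e) tvec \<Rightarrow> real) \<Rightarrow> ('b \<Rightarrow> ('b, 'f) tvec \<Rightarrow> real) \<Rightarrow>
   ('a \<Rightarrow> real) \<Rightarrow> ('b \<Rightarrow> real) \<Rightarrow>
   'a \<times> 'b \<Rightarrow> ('a \<times> 'b, 'e \<times> 'f) tvec \<Rightarrow> real" where
  "doubly_warped_product A1 A2 F1 F2 f1 f2 p v =
     sqrt ((f2 (snd p))\<^sup>2 * (F1 (fst p) (dfst A1 A2 p v))\<^sup>2 +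
           (f1 (fst p))\<^sup>2 * (F2 (snd p) (dsnd A1 A2 p v))\<^sup>2)"

lemma convolution_eq_doubly_warped_product:
  assumes M1: "smooth_manifold M1 A1" and M2: "smooth_manifold M2 A2"
    and const: "(\<exists>k. \<forall>x\<in>topspace M1. f1 x = k) \<or> (\<exists>k. \<forall>x\<in>topspace M2. f2 x = k)"
    and p: "p \<in> (\<Union>e\<in>prod_atlas A1 A2. fst e)"
  shows "convolution A1 A2 F1 F2 f1 f2 p v = doubly_warped_product A1 A2 F1 F2 f1 f2 p v"
proof -
  have "fst p \<in> (\<Union>c\<in>A1. fst c)" "snd p \<in> (\<Union>d\<in>A2. fst d)"
    using p unfolding prod_atlas_domain mem_Times_iff by blast+
  note c1 = chart_at_props[OF this(1)] and c2 = chart_at_props[OF this(2)]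
  have zero: "r * s * gradient A1 F1 f1 (chart_at A1 (fst p)) (fst p) y1 i *
      gradient A2 F2 f2 (chart_at A2 (snd p)) (snd p) y2 j = 0" for r s y1 y2 i j
    using const gradient_of_constant[OF M1 c1, of f1 _ F1 y1 i] gradient_of_constant[OF M2 c2, of f2 _ F2 y2 j]
    unfolding mult_eq_0_iff by blast
  then show ?thesis
    unfolding convolution_def doubly_warped_product_def Let_def zero by simp
qed

text \<open>
  Below, \<open>G\<close> stands for the convolution. Outside the product manifold \<open>chart_at\<close> is arbitrary and the
  mixed term of the convolution need not vanish, so the two functions are only identified over points
  of the manifold.
\<close>
context
  fixes M1 :: "'a topology" and A1 :: "('a, 'e::euclidean_space) chart set"
    and M2 :: "'b topology" and A2 :: "('b, 'f::euclidean_space) chart set"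
    and a1 \<beta>1 F1 a2 \<beta>2 F2 f1 f2 G
  assumes M1: "smooth_manifold M1 A1" and M2: "smooth_manifold M2 A2"
    and R1: "randers_with A1 (slit_bundle A1) a1 \<beta>1 F1"
    and R2: "randers_with A2 (slit_bundle A2) a2 \<beta>2 F2"
    and f1: "smooth_function A1 f1" "\<And>x. x \<in> (\<Union>c\<in>A1. fst c) \<Longrightarrow> f1 x > 0"
    and f2: "smooth_function A2 f2" "\<And>x. x \<in> (\<Union>d\<in>A2. fst d) \<Longrightarrow> f2 x > 0"
    and G: "\<And>p v. p \<in> (\<Union>e\<in>prod_atlas A1 A2. fst e) \<Longrightarrow>
      G p v = doubly_warped_product A1 A2 F1 F2 f1 f2 p v"
begin

lemma warped_of_coords:
  assumes c: "c \<in> A1" "x1 \<in> fst c" and d: "d \<in> A2" "x2 \<in> fst d"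
  shows "G (x1, x2) (of_coords (prod_atlas A1 A2) (prod_chart c d) (x1, x2) y) =
    sqrt ((f2 x2 * F1 x1 (of_coords A1 c x1 (fst y)))\<^sup>2 + (f1 x1 * F2 x2 (of_coords A2 d x2 (snd y)))\<^sup>2)"
proof -
  have "(x1, x2) \<in> (\<Union>e\<in>prod_atlas A1 A2. fst e)"
    unfolding prod_atlas_domain using c d by blast
  then show ?thesis
    by (simp add: G doubly_warped_product_def dfst_dsnd_of_coords[OF M1 M2 c d] power_mult_distrib)
qed

text \<open>
  Restricting the Randers decomposition to the plane spanned by \<open>(v\<^sub>1, 0)\<close> and
  \<open>(0, v\<^sub>2)\<close> leads to \<open>binary_randers_norm_forms_vanish\<close>.
\<close>
lemma warped_randers_imp_forms_vanish:
  assumes R: "randers_metric (prod_atlas A1 A2) (slit_prod_bundle A1 A2) G"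
    and 1: "(x1, v1) \<in> slit_bundle A1" and 2: "(x2, v2) \<in> slit_bundle A2"
  shows "\<beta>1 x1 v1 = 0 \<and> \<beta>2 x2 v2 = 0"
proof -
  let ?P = "prod_atlas A1 A2"
  obtain a b where R: "randers_with ?P (slit_prod_bundle A1 A2) a b G"
    using R unfolding randers_metric_def by blast
  obtain c where c: "c \<in> A1" "x1 \<in> fst c" and v1: "v1 \<in> tangent_space A1 x1" "v1 \<noteq> (\<lambda>_. 0)"
    using 1 by (auto simp: slit_bundle_def tangent_bundle_def)
  obtain d where d: "d \<in> A2" "x2 \<in> fst d" and v2: "v2 \<in> tangent_space A2 x2" "v2 \<noteq> (\<lambda>_. 0)"
    using 2 by (auto simp: slit_bundle_def tangent_bundle_def)
  define y1 where "y1 = v1 c"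
  define y2 where "y2 = v2 d"
  have v1_eq: "v1 = of_coords A1 c x1 y1" and v2_eq: "v2 = of_coords A2 d x2 y2"
    using of_coords_of_tangent[OF c v1(1)] of_coords_of_tangent[OF d v2(1)] by (simp_all add: y1_def y2_def)
  have y: "y1 \<noteq> 0" "y2 \<noteq> 0"
    using v1(2) v2(2) of_coords_eq_0_iff[OF M1 c] of_coords_eq_0_iff[OF M2 d] by (auto simp: v1_eq v2_eq)
  have e: "prod_chart c d \<in> ?P" "(x1, x2) \<in> fst (prod_chart c d)"
    using c d by (auto intro: prod_chart_in_prod_atlas)
  have ra: "riemannian_metric ?P a" and rb: "one_form ?P b"
    and sum: "\<forall>(p, v)\<in>slit_prod_bundle A1 A2. G p v = riem_norm a p v + b p v"
    using R unfolding randers_with_def by - (elim conjE, assumption)+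
  define w where "w y = of_coords ?P (prod_chart c d) (x1, x2) y" for y
  define Q where "Q y z = a (x1, x2) (w y) (w z)" for y z
  define L where "L y = b (x1, x2) (w y)" for y
  have Q: "bilinear Q" and Qsym: "Q y z = Q z y" and Q_nonneg: "Q y y \<ge> 0" for y z
    using riemannian_metric_props(1,2,4)[OF ra e] by (simp_all add: Q_def[abs_def] w_def)
  have L: "linear L"
    using one_form_linear[OF rb e] by (simp add: L_def[abs_def] w_def)
  let ?u1 = "(y1, 0)" and ?u2 = "(0, y2)"
  have split: "(s *\<^sub>R y1, t *\<^sub>R y2) = s *\<^sub>R ?u1 + t *\<^sub>R ?u2" for s t
    by simp
  have Q_split: "Q (s *\<^sub>R y1, t *\<^sub>R y2) (s *\<^sub>R y1, t *\<^sub>R y2) =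
      Q ?u1 ?u1 * s\<^sup>2 + 2 * Q ?u1 ?u2 * s * t + Q ?u2 ?u2 * t\<^sup>2" for s t
    unfolding split bilinear_ladd[OF Q] bilinear_radd[OF Q] bilinear_lmul[OF Q] bilinear_rmul[OF Q]
      Qsym[of ?u2 ?u1]
    by (simp add: power2_eq_square algebra_simps)
  have L_split: "L (s *\<^sub>R y1, t *\<^sub>R y2) = L ?u1 * s + L ?u2 * t" for s t
    unfolding split linear_add[OF L] linear_scale[OF L] by simp
  define \<alpha>1 where "\<alpha>1 = riem_norm a1 x1 v1"
  define \<alpha>2 where "\<alpha>2 = riem_norm a2 x2 v2"
  have f_pos: "f1 x1 > 0" "f2 x2 > 0"
    using f1(2) f2(2) c d by blast+
  have "riemannian_metric A1 a1" "riemannian_metric A2 a2"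
    using R1 R2 unfolding randers_with_def by blast+
  then have \<alpha>: "\<alpha>1 > 0" "\<alpha>2 > 0"
    using riemannian_metric_props(3)[OF _ c y(1)] riemannian_metric_props(3)[OF _ d y(2)]
    by (simp_all add: \<alpha>1_def \<alpha>2_def riem_norm_def v1_eq v2_eq)
  have \<beta>: "\<bar>\<beta>1 x1 v1\<bar> \<le> \<alpha>1" "\<bar>\<beta>2 x2 v2\<bar> \<le> \<alpha>2"
    using abs_form_le_riem_norm[OF M1 R1 c y(1)] abs_form_le_riem_norm[OF M2 R2 d y(2)]
    by (simp_all add: \<alpha>1_def \<alpha>2_def v1_eq v2_eq)
  have eq: "sqrt (Q ?u1 ?u1 * s\<^sup>2 + 2 * Q ?u1 ?u2 * s * t + Q ?u2 ?u2 * t\<^sup>2) + (L ?u1 * s + L ?u2 * t) =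
      sqrt ((\<bar>s\<bar> * (f2 x2 * \<alpha>1) + s * (f2 x2 * \<beta>1 x1 v1))\<^sup>2 +
            (\<bar>t\<bar> * (f1 x1 * \<alpha>2) + t * (f1 x1 * \<beta>2 x2 v2))\<^sup>2)"
    if st: "s \<noteq> 0" "t \<noteq> 0" for s t
  proof -
    let ?w = "(s *\<^sub>R y1, t *\<^sub>R y2)"
    have "((x1, x2), w ?w) \<in> slit_prod_bundle A1 A2"
      using of_coords_in_slit_prod_bundle_iff[OF M1 M2 c d] st y by (simp add: w_def)
    from bspec[OF sum this] have "G (x1, x2) (w ?w) = sqrt (Q ?w ?w) + L ?w"
      by (simp add: Q_def L_def riem_norm_def)
    moreover have "G (x1, x2) (w ?w) =
      sqrt ((f2 x2 * F1 x1 (of_coords A1 c x1 (s *\<^sub>R y1)))\<^sup>2 + (f1 x1 * F2 x2 (of_coords A2 d x2 (t *\<^sub>R y2)))\<^sup>2)"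
      using warped_of_coords[OF c d, of ?w] by (simp add: w_def)
    ultimately show ?thesis
      unfolding Q_split L_split randers_with_scaleR[OF M1 R1 c y(1) st(1)]
        randers_with_scaleR[OF M2 R2 d y(2) st(2)]
      by (simp add: \<alpha>1_def \<alpha>2_def v1_eq v2_eq algebra_simps)
  qed
  have nonneg: "Q ?u1 ?u1 * s\<^sup>2 + 2 * Q ?u1 ?u2 * s * t + Q ?u2 ?u2 * t\<^sup>2 \<ge> 0" for s t
    unfolding Q_split[symmetric] using Q_nonneg .
  have "f2 x2 * \<beta>1 x1 v1 = 0" "f1 x1 * \<beta>2 x2 v2 = 0"
    by (rule binary_randers_norm_forms_vanish[OF _ _ _ _ nonneg eq];
        use \<alpha> \<beta> f_pos in \<open>simp add: abs_mult mult_left_mono\<close>)+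
  then show ?thesis
    using f_pos by simp
qed

definition warped_tensor ::
  "'a \<times> 'b \<Rightarrow> ('a \<times> 'b, 'e \<times> 'f) tvec \<Rightarrow> ('a \<times> 'b, 'e \<times> 'f) tvec \<Rightarrow> real" where
  "warped_tensor p v w =
     (f2 (snd p))\<^sup>2 * a1 (fst p) (dfst A1 A2 p v) (dfst A1 A2 p w) +
     (f1 (fst p))\<^sup>2 * a2 (snd p) (dsnd A1 A2 p v) (dsnd A1 A2 p w)"

lemma riem1: "riemannian_metric A1 a1" and riem2: "riemannian_metric A2 a2"
  using R1 R2 unfolding randers_with_def by blast+

lemma warped_tensor_of_coords:
  assumes c: "c \<in> A1" "x1 \<in> fst c" and d: "d \<in> A2" "x2 \<in> fst d"
  shows "warped_tensor (x1, x2) (of_coords (prod_atlas A1 A2) (prod_chart c d) (x1, x2) y) (of_coords (prod_atlas A1 A2) (prod_chart c d) (x1, x2) z) =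
    (f2 x2)\<^sup>2 * a1 x1 (of_coords A1 c x1 (fst y)) (of_coords A1 c x1 (fst z)) +
    (f1 x1)\<^sup>2 * a2 x2 (of_coords A2 d x2 (snd y)) (of_coords A2 d x2 (snd z))"
  by (simp add: warped_tensor_def dfst_dsnd_of_coords[OF M1 M2 c d])

lemma warped_tensor_inner_product:
  assumes c: "c \<in> A1" "x1 \<in> fst c" and d: "d \<in> A2" "x2 \<in> fst d"
  defines "B \<equiv> \<lambda>y z. warped_tensor (x1, x2)
    (of_coords (prod_atlas A1 A2) (prod_chart c d) (x1, x2) y) (of_coords (prod_atlas A1 A2) (prod_chart c d) (x1, x2) z)"
  shows "bilinear B" "B y z = B z y" "y \<noteq> 0 \<Longrightarrow> B y y > 0" "B y y \<ge> 0"
proof -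
  note a1 = riemannian_metric_props[OF riem1 c] and a2 = riemannian_metric_props[OF riem2 d]
  note B = warped_tensor_of_coords[OF c d, folded B_def]
  show bil: "bilinear B"
    unfolding B_def warped_tensor_of_coords[OF c d] by (rule bilinear_direct_sum[OF a1(1) a2(1)])
  show "B y z = B z y"
    unfolding B_def warped_tensor_of_coords[OF c d]
    using a1(2)[of "fst y" "fst z"] a2(2)[of "snd y" "snd z"] by simp
  show pos: "B y y > 0" if y: "y \<noteq> 0" for y
  proof -
    have f: "f1 x1 > 0" "f2 x2 > 0"
      using f1(2) f2(2) c d by blast+
    consider "fst y \<noteq> 0" | "snd y \<noteq> 0"
      using y by (auto simp: prod_eq_iff)
    then show ?thesis
    proof cases
      case 1
      then show ?thesis
        unfolding B_def warped_tensor_of_coords[OF c d] using f a1(3) a2(4)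
        by (intro add_pos_nonneg mult_pos_pos mult_nonneg_nonneg) auto
    next
      case 2
      then show ?thesis
        unfolding B_def warped_tensor_of_coords[OF c d] using f a1(4) a2(3)
        by (intro add_nonneg_pos mult_pos_pos mult_nonneg_nonneg) auto
    qed
  qed
  show "B y y \<ge> 0"
    using pos[of y] bilinear_lzero[OF bil] by (cases "y = 0") (simp_all add: less_imp_le)
qed

lemma riemannian_metric_warped_tensor: "riemannian_metric (prod_atlas A1 A2) warped_tensor"
  unfolding riemannian_metric_def
proof (intro conjI ballI)
  fix e p assume e: "e \<in> (prod_atlas A1 A2)" "p \<in> fst e"
  obtain c d where cd: "e = prod_chart c d" "c \<in> A1" "d \<in> A2"
    using e(1) by (rule prod_atlasE)
  obtain x1 x2 where p: "p = (x1, x2)" by fastforce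
  with e(2) cd(1) have x: "x1 \<in> fst c" "x2 \<in> fst d" by simp_all
  note B = warped_tensor_inner_product[OF cd(2) x(1) cd(3) x(2), folded cd(1) p]
  show bil: "bilinear (\<lambda>y z. warped_tensor p (of_coords (prod_atlas A1 A2) e p y) (of_coords (prod_atlas A1 A2) e p z))"
    by (rule B(1))
  show "pos_def_matrix (\<lambda>i j. warped_tensor p (of_coords (prod_atlas A1 A2) e p i) (of_coords (prod_atlas A1 A2) e p j))"
    unfolding pos_def_matrix_bilinear_iff[OF bil] using B(2,3) by blast
next
  fix e i j assume e: "e \<in> (prod_atlas A1 A2)" and ij: "i \<in> (Basis :: ('e \<times> 'f) set)" "j \<in> (Basis :: ('e \<times> 'f) set)"
  obtain c d where cd: "e = prod_chart c d" "c \<in> A1" "d \<in> A2"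
    using e(1) by (rule prod_atlasE)
  let ?U = "snd c ` fst c" and ?V = "snd d ` fst d"
  let ?g1 = "\<lambda>x. a1 (chart_inv c x) (of_coords A1 c (chart_inv c x) (fst i)) (of_coords A1 c (chart_inv c x) (fst j))"
  let ?g2 = "\<lambda>x. a2 (chart_inv d x) (of_coords A2 d (chart_inv d x) (snd i)) (of_coords A2 d (chart_inv d x) (snd j))"
  let ?h1 = "f1 \<circ> chart_inv c" and ?h2 = "f2 \<circ> chart_inv d"
  have im: "snd e ` fst e = ?U \<times> ?V"
    by (simp only: cd(1) prod_chart_image)
  have o: "open (?U \<times> ?V)"
    using chart_props(2)[OF M1 cd(2)] chart_props(2)[OF M2 cd(3)] by (rule open_Times)
  have basis: "fst i \<in> insert 0 Basis" "fst j \<in> insert 0 Basis" "snd i \<in> insert 0 Basis" "snd j \<in> insert 0 Basis"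
    using ij by (auto simp: Basis_prod_def)
  have g: "smooth_on ?U ?g1" "smooth_on ?V ?g2"
    using riemannian_metric_component_smooth[OF M1 riem1 cd(2) basis(1,2)]
      riemannian_metric_component_smooth[OF M2 riem2 cd(3) basis(3,4)] by simp_all
  have h: "smooth_on ?U ?h1" "smooth_on ?V ?h2"
    using f1(1) f2(1) cd unfolding smooth_function_def by blast+
  have pull: "smooth_on (?U \<times> ?V) (\<lambda>x. u (fst x))" if "smooth_on ?U u" for u :: "'e \<Rightarrow> real"
    by (rule smooth_on_compose_linear[OF o bounded_linear_fst that]) auto
  have pull': "smooth_on (?U \<times> ?V) (\<lambda>x. u (snd x))" if "smooth_on ?V u" for u :: "'f \<Rightarrow> real"
    by (rule smooth_on_compose_linear[OF o bounded_linear_snd that]) auto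
  have "smooth_on (?U \<times> ?V) (\<lambda>x. ?h2 (snd x) * ?h2 (snd x) * ?g1 (fst x) + ?h1 (fst x) * ?h1 (fst x) * ?g2 (snd x))"
    by (intro smooth_on_add[OF o] smooth_on_mult[OF o] pull[OF g(1)] pull[OF h(1)] pull'[OF g(2)] pull'[OF h(2)])
  then show "smooth_on (snd e ` fst e)
      (\<lambda>x. warped_tensor (chart_inv e x) (of_coords (prod_atlas A1 A2) e (chart_inv e x) i) (of_coords (prod_atlas A1 A2) e (chart_inv e x) j))"
    unfolding im
  proof (rule smooth_on_cong[OF o, rotated])
    fix x assume x: "x \<in> ?U \<times> ?V"
    obtain y1 y2 where y: "x = (y1, y2)" "y1 \<in> ?U" "y2 \<in> ?V"
      using x by blast
    have inv: "chart_inv e x = (chart_inv c y1, chart_inv d y2)"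
      unfolding cd(1) y(1) by (rule chart_inv_prod_chart[OF chart_inj[OF M1 cd(2)] chart_inj[OF M2 cd(3)] y(2,3)])
    have dom: "chart_inv c y1 \<in> fst c" "chart_inv d y2 \<in> fst d"
      using y chart_inv_chart[OF M1 cd(2)] chart_inv_chart[OF M2 cd(3)] by auto
    show "?h2 (snd x) * ?h2 (snd x) * ?g1 (fst x) + ?h1 (fst x) * ?h1 (fst x) * ?g2 (snd x) =
      warped_tensor (chart_inv e x) (of_coords (prod_atlas A1 A2) e (chart_inv e x) i) (of_coords (prod_atlas A1 A2) e (chart_inv e x) j)"
      unfolding inv unfolding cd(1) warped_tensor_of_coords[OF cd(2) dom(1) cd(3) dom(2)]
      by (simp add: y(1) power2_eq_square)
  qed
qed

context
  assumes \<beta>1: "\<And>x v. (x, v) \<in> slit_bundle A1 \<Longrightarrow> \<beta>1 x v = 0"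
    and \<beta>2: "\<And>x v. (x, v) \<in> slit_bundle A2 \<Longrightarrow> \<beta>2 x v = 0"
begin

lemma square_warped:
  assumes c: "c \<in> A1" "x1 \<in> fst c" and d: "d \<in> A2" "x2 \<in> fst d"
  defines "w \<equiv> of_coords (prod_atlas A1 A2) (prod_chart c d) (x1, x2)"
  shows "(G (x1, x2) (w y))\<^sup>2 = warped_tensor (x1, x2) (w y) (w y)"
  unfolding w_def warped_of_coords[OF c d] warped_tensor_of_coords[OF c d]
    real_sqrt_pow2[OF add_nonneg_nonneg[OF zero_le_power2 zero_le_power2]]
  by (simp add: power_mult_distrib randers_with_zero_form_square[OF M1 R1 \<beta>1 c]
      randers_with_zero_form_square[OF M2 R2 \<beta>2 d])

lemma warped_nonneg: "p \<in> (\<Union>e\<in>prod_atlas A1 A2. fst e) \<Longrightarrow> G p v \<ge> 0"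
  by (simp add: G doubly_warped_product_def)

text \<open>
  In product coordinates the domain is an open product set, and there \<open>G\<close> is the square root of
  a positive combination of the smooth functions \<open>F1\<close>, \<open>F2\<close>, \<open>f1\<close>, \<open>f2\<close>, each composed with a
  linear projection.
\<close>
lemma warped_smooth:
  assumes e: "e \<in> prod_atlas A1 A2"
  shows "smooth_on
    {(x, y). x \<in> snd e ` fst e \<and>
       (chart_inv e x, of_coords (prod_atlas A1 A2) e (chart_inv e x) y) \<in> slit_prod_bundle A1 A2}
    (\<lambda>(x, y). G (chart_inv e x) (of_coords (prod_atlas A1 A2) e (chart_inv e x) y))"
    (is "smooth_on ?T ?G")
proof -
  obtain c d where cd: "e = prod_chart c d" "c \<in> A1" "d \<in> A2"
    using e by (rule prod_atlasE)
  let ?U = "snd c ` fst c" and ?V = "snd d ` fst d"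
  let ?S = "(?U \<times> ?V) \<times> ((- {0}) \<times> (- {0})) :: (('e \<times> 'f) \<times> ('e \<times> 'f)) set"
  let ?k1 = "\<lambda>(x, y). F1 (chart_inv c x) (of_coords A1 c (chart_inv c x) y)"
  let ?k2 = "\<lambda>(x, y). F2 (chart_inv d x) (of_coords A2 d (chart_inv d x) y)"
  let ?S1 = "{(x, y). x \<in> ?U \<and> (chart_inv c x, of_coords A1 c (chart_inv c x) y) \<in> slit_bundle A1}"
  let ?S2 = "{(x, y). x \<in> ?V \<and> (chart_inv d x, of_coords A2 d (chart_inv d x) y) \<in> slit_bundle A2}"
  let ?h1 = "f1 \<circ> chart_inv c" and ?h2 = "f2 \<circ> chart_inv d"
  have dom: "chart_inv c x1 \<in> fst c" if "x1 \<in> ?U" for x1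
    using that chart_inv_chart[OF M1 cd(2)] by auto
  have dom': "chart_inv d x2 \<in> fst d" if "x2 \<in> ?V" for x2
    using that chart_inv_chart[OF M2 cd(3)] by auto
  have inv: "chart_inv e (x1, x2) = (chart_inv c x1, chart_inv d x2)" if "x1 \<in> ?U" "x2 \<in> ?V" for x1 x2
    unfolding cd(1) by (rule chart_inv_prod_chart[OF chart_inj[OF M1 cd(2)] chart_inj[OF M2 cd(3)] that])
  have T_eq: "?T = ?S"
  proof -
    have im: "snd e ` fst e = ?U \<times> ?V"
      by (simp only: cd(1) prod_chart_image)
    have eq: "((x1, x2), y) \<in> ?T \<longleftrightarrow> ((x1, x2), y) \<in> ?S" for x1 x2 y
    proof (cases "x1 \<in> ?U \<and> x2 \<in> ?V")
      case True
      then show ?thesis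
        unfolding im using of_coords_in_slit_prod_bundle_iff[OF M1 M2 cd(2) dom cd(3) dom', of x1 x2 y]
        by (cases y) (simp add: inv cd(1)[symmetric])
    next
      case False
      then show ?thesis
        unfolding im by (cases y) auto
    qed
    show ?thesis
    proof (rule set_eqI)
      fix z :: "('e \<times> 'f) \<times> ('e \<times> 'f)"
      obtain x1 x2 y where "z = ((x1, x2), y)"
        by (metis surj_pair)
      then show "z \<in> ?T \<longleftrightarrow> z \<in> ?S"
        using eq by (simp only:)
    qed
  qed
  have S1: "?S1 = ?U \<times> (- {0})" and S2: "?S2 = ?V \<times> (- {0})"
    using of_coords_in_slit_bundle_iff[OF M1 cd(2) dom] of_coords_in_slit_bundle_iff[OF M2 cd(3) dom']
    by auto
  have o: "open ?S"
    using chart_props(2)[OF M1 cd(2)] chart_props(2)[OF M2 cd(3)] by (intro open_Times open_Compl closed_singleton)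
  have "finsler_metric A1 (slit_bundle A1) F1" "finsler_metric A2 (slit_bundle A2) F2"
    using R1 R2 unfolding randers_with_def by blast+
  then have "smooth_on ?S1 ?k1" "smooth_on ?S2 ?k2"
    using finsler_metric_smooth[OF _ cd(2)] finsler_metric_smooth[OF _ cd(3)] by blast+
  then have k: "smooth_on (?U \<times> (- {0})) ?k1" "smooth_on (?V \<times> (- {0})) ?k2"
    unfolding S1 S2 .
  have h: "smooth_on ?U ?h1" "smooth_on ?V ?h2"
    using f1(1) f2(1) cd unfolding smooth_function_def by blast+
  have pull: "smooth_on ?S (\<lambda>z. ?k1 (fst (fst z), fst (snd z)))" "smooth_on ?S (\<lambda>z. ?k2 (snd (fst z), snd (snd z)))"
    "smooth_on ?S (\<lambda>z. ?h1 (fst (fst z)))" "smooth_on ?S (\<lambda>z. ?h2 (snd (fst z)))"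
    by (rule smooth_on_compose_linear[OF o _ k(1)] smooth_on_compose_linear[OF o _ k(2)]
        smooth_on_compose_linear[OF o _ h(1)] smooth_on_compose_linear[OF o _ h(2)];
      force intro!: bounded_linear_Pair bounded_linear_fst_comp bounded_linear_snd_comp bounded_linear_fst bounded_linear_snd)+
  let ?q = "\<lambda>z. (?h2 (snd (fst z)) * ?k1 (fst (fst z), fst (snd z))) * (?h2 (snd (fst z)) * ?k1 (fst (fst z), fst (snd z)))
      + (?h1 (fst (fst z)) * ?k2 (snd (fst z), snd (snd z))) * (?h1 (fst (fst z)) * ?k2 (snd (fst z), snd (snd z)))"
  have q: "smooth_on ?S ?q"
    by (intro smooth_on_add[OF o] smooth_on_mult[OF o] pull)
  have G_eq: "?G z = sqrt (?q z)" and q_pos: "?q z > 0" if z: "z \<in> ?S" for z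
  proof -
    obtain x1 x2 y1 y2 where z_eq: "z = ((x1, x2), (y1, y2))"
      by (metis surj_pair)
    with z have x: "x1 \<in> ?U" "x2 \<in> ?V" and y: "y1 \<noteq> 0" "y2 \<noteq> 0" by auto
    show G_eq: "?G z = sqrt (?q z)"
      using warped_of_coords[OF cd(2) dom[OF x(1)] cd(3) dom'[OF x(2)], of "(y1, y2)"]
      by (simp add: z_eq inv[OF x] cd(1)[symmetric] power2_eq_square)
    have "0 < warped_tensor (chart_inv c x1, chart_inv d x2)
        (of_coords (prod_atlas A1 A2) e (chart_inv c x1, chart_inv d x2) (y1, y2))
        (of_coords (prod_atlas A1 A2) e (chart_inv c x1, chart_inv d x2) (y1, y2))"
      unfolding cd(1) by (rule warped_tensor_inner_product(3)[OF cd(2) dom[OF x(1)] cd(3) dom'[OF x(2)]])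
        (use y in \<open>simp add: zero_prod_def\<close>)
    also have "\<dots> = (?G z)\<^sup>2"
      using square_warped[OF cd(2) dom[OF x(1)] cd(3) dom'[OF x(2)], of "(y1, y2)"]
      by (simp add: z_eq inv[OF x] cd(1)[symmetric])
    finally have "?q z \<noteq> 0"
      unfolding G_eq zero_less_power2 real_sqrt_eq_0_iff .
    moreover have "?q z \<ge> 0"
      by simp
    ultimately show "?q z > 0"
      by (rule order.not_eq_order_implies_strict[OF not_sym])
  qed
  show ?thesis
    unfolding T_eq by (rule smooth_on_cong[OF o G_eq[symmetric] smooth_on_sqrt[OF o q_pos q]])
qed

text \<open>
  By \<open>square_warped\<close>, \<open>G\<^sup>2\<close> agrees with the quadratic form of \<open>warped_tensor\<close> on entire
  tangent spaces, so that form is the Hessian matrix and positivity is inherited from it.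
\<close>
lemma finsler_metric_warped: "finsler_metric (prod_atlas A1 A2) (slit_prod_bundle A1 A2) G"
proof -
  let ?P = "prod_atlas A1 A2"
  note M = smooth_manifold_prod[OF M1 M2]
  have "G p v \<ge> 0" if "(p, v) \<in> tangent_bundle ?P" for p v
    using that by (intro warped_nonneg) (auto simp: tangent_bundle_def)
  moreover have "G p (\<lambda>e. r *\<^sub>R v e) = r * G p v" if t: "(p, v) \<in> tangent_bundle ?P" and r: "r > 0" for p v r
  proof -
    obtain c d x1 x2 y where p: "p = (x1, x2)" and c: "c \<in> A1" "x1 \<in> fst c" and d: "d \<in> A2" "x2 \<in> fst d"
      and v: "v = of_coords ?P (prod_chart c d) (x1, x2) y"
      using prod_tangent_vectorE[OF M1 M2 t] .
    have e: "prod_chart c d \<in> ?P" "(x1, x2) \<in> fst (prod_chart c d)"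
      using c d by (auto intro: prod_chart_in_prod_atlas)
    have "G p (\<lambda>e. r *\<^sub>R v e) = sqrt (r\<^sup>2 * ((f2 x2 * F1 x1 (of_coords A1 c x1 (fst y)))\<^sup>2 +
        (f1 x1 * F2 x2 (of_coords A2 d x2 (snd y)))\<^sup>2))"
      unfolding p v of_coords_scaleR[OF M e, symmetric] warped_of_coords[OF c d]
      using r by (simp add: randers_with_coords(3)[OF M1 R1 c] randers_with_coords(3)[OF M2 R2 d]
          power_mult_distrib algebra_simps)
    also have "\<dots> = r * G p v"
      unfolding p v warped_of_coords[OF c d] using r by (simp add: real_sqrt_mult)
    finally show ?thesis .
  qed
  moreover have "pos_def_matrix (hessian ?P G e p (v e))" if e: "e \<in> ?P" "p \<in> fst e" for e p v
  proof -
    obtain c d where cd: "e = prod_chart c d" "c \<in> A1" "d \<in> A2"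
      using e(1) by (rule prod_atlasE)
    obtain x1 x2 where p: "p = (x1, x2)" by fastforce
    with e(2) cd(1) have x: "x1 \<in> fst c" "x2 \<in> fst d" by simp_all
    note B = warped_tensor_inner_product[OF cd(2) x(1) cd(3) x(2), folded cd(1) p]
    have "hessian ?P G e p (v e) =
        (\<lambda>i j. warped_tensor p (of_coords ?P e p i) (of_coords ?P e p j))"
      unfolding hessian_def square_warped[OF cd(2) x(1) cd(3) x(2), folded cd(1) p]
      by (intro ext half_second_partial_of_quadratic_form[OF B(1,2)])
    then show ?thesis
      using B(2,3) by (simp only: pos_def_matrix_bilinear_iff[OF B(1)]) blast
  qed
  ultimately show ?thesis
    unfolding finsler_metric_def using warped_smooth by blast
qed

lemma forms_vanish_imp_warped_randers: "randers_metric (prod_atlas A1 A2) (slit_prod_bundle A1 A2) G"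
proof -
  let ?P = "prod_atlas A1 A2"
  have "G p v = riem_norm warped_tensor p v + 0" if "(p, v) \<in> slit_prod_bundle A1 A2" for p v
  proof -
    have t: "(p, v) \<in> tangent_bundle ?P"
      using that unfolding slit_prod_bundle_def by simp
    then obtain c d x1 x2 y where p: "p = (x1, x2)" and c: "c \<in> A1" "x1 \<in> fst c" and d: "d \<in> A2" "x2 \<in> fst d"
      and v: "v = of_coords ?P (prod_chart c d) (x1, x2) y"
      by (rule prod_tangent_vectorE[OF M1 M2])
    have "G p v \<ge> 0"
      using t by (intro warped_nonneg) (auto simp: tangent_bundle_def)
    then show ?thesis
      using square_warped[OF c d, of y] unfolding riem_norm_def p v by (metis add.right_neutral real_sqrt_abs abs_of_nonneg)
  qed
  then show ?thesis
    unfolding randers_metric_def randers_with_def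
    using finsler_metric_warped riemannian_metric_warped_tensor
    by (intro exI[of _ warped_tensor] exI[of _ "\<lambda>_ _. 0"])
      (auto simp: one_form_zero form_norm_zero)
qed

end

end

section \<open>Proportionality of the metrics and the forms\<close>

text \<open>
  Compare the proportion at \<open>(v\<^sub>1, v\<^sub>2)\<close> with the one at \<open>(-v\<^sub>1, v\<^sub>2)\<close>: the term
  \<open>\<alpha>\<^sub>2 \<beta>\<^sub>1\<close> changes sign and \<open>\<alpha>\<^sub>1 \<beta>\<^sub>2\<close> does not, so both are zero. If one slit bundle
  is empty, both sides hold vacuously and say nothing about the form on the other factor.
\<close>
lemma same_ratio_iff_forms_vanish:
  assumes M1: "smooth_manifold M1 A1" and M2: "smooth_manifold M2 A2"
    and R1: "randers_with A1 (slit_bundle A1) a1 \<beta>1 F1"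
    and R2: "randers_with A2 (slit_bundle A2) a2 \<beta>2 F2"
  shows "(\<forall>(x1, y1)\<in>slit_bundle A1. \<forall>(x2, y2)\<in>slit_bundle A2.
      same_ratio (riem_norm a1 x1 y1) (riem_norm a2 x2 y2) (\<beta>1 x1 y1) (\<beta>2 x2 y2)) \<longleftrightarrow>
    (\<forall>(x1, y1)\<in>slit_bundle A1. \<forall>(x2, y2)\<in>slit_bundle A2. \<beta>1 x1 y1 = 0 \<and> \<beta>2 x2 y2 = 0)"
    (is "?ratio \<longleftrightarrow> ?zero")
proof
  assume ratio: ?ratio
  have "\<beta>1 x1 v1 = 0 \<and> \<beta>2 x2 v2 = 0"
    if 1: "(x1, v1) \<in> slit_bundle A1" and 2: "(x2, v2) \<in> slit_bundle A2" for x1 v1 x2 v2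
  proof -
    have a: "riemannian_metric A1 a1" "riemannian_metric A2 a2" and b: "one_form A1 \<beta>1"
      using R1 R2 unfolding randers_with_def by blast+
    obtain c where c: "c \<in> A1" "x1 \<in> fst c" and v1: "v1 \<in> tangent_space A1 x1" "v1 \<noteq> (\<lambda>_. 0)"
      using 1 by (auto simp: slit_bundle_def tangent_bundle_def)
    obtain d where d: "d \<in> A2" "x2 \<in> fst d" and v2: "v2 \<in> tangent_space A2 x2" "v2 \<noteq> (\<lambda>_. 0)"
      using 2 by (auto simp: slit_bundle_def tangent_bundle_def)
    define y1 where "y1 = v1 c"
    have v1_eq: "v1 = of_coords A1 c x1 y1"
      using of_coords_of_tangent[OF c v1(1)] by (simp add: y1_def)
    have y1: "y1 \<noteq> 0"
      using v1(2) of_coords_eq_0_iff[OF M1 c] by (auto simp: v1_eq)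
    have y2: "v2 d \<noteq> 0"
      using v2(2) of_coords_eq_0_iff[OF M2 d, of "v2 d"] of_coords_of_tangent[OF d v2(1)] by auto
    let ?w = "of_coords A1 c x1 ((-1) *\<^sub>R y1)"
    have w: "(x1, ?w) \<in> slit_bundle A1"
      using of_coords_in_slit_bundle_iff[OF M1 c] y1 by simp
    have \<alpha>: "riem_norm a1 x1 v1 > 0" "riem_norm a2 x2 v2 > 0"
      using riemannian_metric_props(3)[OF a(1) c y1] riemannian_metric_props(3)[OF a(2) d y2]
      by (simp_all add: riem_norm_def v1_eq of_coords_of_tangent[OF d v2(1)])
    have flip: "riem_norm a1 x1 ?w = riem_norm a1 x1 v1" "\<beta>1 x1 ?w = - \<beta>1 x1 v1"
      using riem_norm_scaleR[OF a(1) c, of "-1" y1] linear_scale[OF one_form_linear[OF b c], of "-1" y1]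
      by (simp_all add: v1_eq)
    have "riem_norm a1 x1 v1 * \<beta>2 x2 v2 = riem_norm a2 x2 v2 * \<beta>1 x1 v1"
      using bspec[OF bspec[OF ratio 1, simplified] 2] by (simp add: same_ratio_def)
    moreover have "riem_norm a1 x1 v1 * \<beta>2 x2 v2 = - (riem_norm a2 x2 v2 * \<beta>1 x1 v1)"
      using bspec[OF bspec[OF ratio w, simplified] 2] flip by (simp add: same_ratio_def)
    ultimately show ?thesis
      using \<alpha> by simp
  qed
  then show ?zero by blast
next
  assume ?zero
  then show ?ratio
    by (fastforce simp: same_ratio_def)
qed

text \<open>
  Euclidean spaces have positive dimension. On a nonempty product, the vanishing of the forms on
  pairs of vectors therefore means that each of them vanishes.
\<close>
lemma slit_bundle_fibre_nonempty:
  fixes A :: "('a, 'e::euclidean_space) chart set"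
  assumes "smooth_manifold M A" "p \<in> (\<Union>c\<in>A. fst c)"
  shows "\<exists>v. (p, v) \<in> slit_bundle A"
proof -
  obtain b :: 'e where "b \<in> Basis"
    by (meson nonempty_Basis ex_in_conv)
  then show ?thesis
    using of_coords_in_slit_bundle_iff[OF assms(1) chart_at_props[OF assms(2)], of b] nonzero_Basis by blast
qed

theorem theorem1p3:
  fixes M1 :: "'a topology" and A1 :: "('a, 'e::euclidean_space) chart set"
    and M2 :: "'b topology" and A2 :: "('b, 'f::euclidean_space) chart set"
    and a1 :: "'a \<Rightarrow> ('a, 'e) tvec \<Rightarrow> ('a, 'e) tvec \<Rightarrow> real"
    and a2 :: "'b \<Rightarrow> ('b, 'f) tvec \<Rightarrow> ('b, 'f) tvec \<Rightarrow> real"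
    and \<beta>1 F1 :: "'a \<Rightarrow> ('a, 'e) tvec \<Rightarrow> real"
    and \<beta>2 F2 :: "'b \<Rightarrow> ('b, 'f) tvec \<Rightarrow> real"
    and f1 :: "'a \<Rightarrow> real" and f2 :: "'b \<Rightarrow> real"
  assumes "smooth_manifold M1 A1" and "smooth_manifold M2 A2"
    and "randers_with A1 (slit_bundle A1) a1 \<beta>1 F1"
    and "randers_with A2 (slit_bundle A2) a2 \<beta>2 F2"
    and "smooth_function A1 f1" and "\<forall>x\<in>topspace M1. f1 x > 0"
    and "smooth_function A2 f2" and "\<forall>x\<in>topspace M2. f2 x > 0"
    and "(\<exists>k. k \<noteq> 0 \<and> (\<forall>x\<in>topspace M1. f1 x = k)) \<or>
         (\<exists>k. k \<noteq> 0 \<and> (\<forall>x\<in>topspace M2. f2 x = k))"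
  shows "randers_metric (prod_atlas A1 A2) (slit_prod_bundle A1 A2)
           (convolution A1 A2 F1 F2 f1 f2) \<longleftrightarrow>
         (\<forall>(x1, y1)\<in>slit_bundle A1. \<forall>(x2, y2)\<in>slit_bundle A2.
            same_ratio (riem_norm a1 x1 y1) (riem_norm a2 x2 y2) (\<beta>1 x1 y1) (\<beta>2 x2 y2))"
proof -
  note M1 = assms(1) and M2 = assms(2) and R1 = assms(3) and R2 = assms(4)
  let ?P = "prod_atlas A1 A2" and ?G = "convolution A1 A2 F1 F2 f1 f2"
  have top: "topspace M1 = (\<Union>c\<in>A1. fst c)" "topspace M2 = (\<Union>d\<in>A2. fst d)"
    using M1 M2 unfolding smooth_manifold_def by simp_all
  have f1: "f1 x > 0" if "x \<in> (\<Union>c\<in>A1. fst c)" for x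
    using assms(6) that unfolding top by blast
  have f2: "f2 x > 0" if "x \<in> (\<Union>d\<in>A2. fst d)" for x
    using assms(8) that unfolding top by blast
  have const: "(\<exists>k. \<forall>x\<in>topspace M1. f1 x = k) \<or> (\<exists>k. \<forall>x\<in>topspace M2. f2 x = k)"
    using assms(9) by blast
  note G = convolution_eq_doubly_warped_product[OF M1 M2 const]
  let ?zero = "\<forall>(x1, y1)\<in>slit_bundle A1. \<forall>(x2, y2)\<in>slit_bundle A2. \<beta>1 x1 y1 = 0 \<and> \<beta>2 x2 y2 = 0"
  have "randers_metric ?P (slit_prod_bundle A1 A2) ?G \<longleftrightarrow> ?zero"
  proof
    assume "randers_metric ?P (slit_prod_bundle A1 A2) ?G"
    from warped_randers_imp_forms_vanish[OF M1 M2 R1 R2 assms(5) f1 assms(7) f2 G this]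
    show ?zero by blast
  next
    assume zero: ?zero
    show "randers_metric ?P (slit_prod_bundle A1 A2) ?G"
    proof (cases "(\<Union>e\<in>?P. fst e) = {}")
      case True
      then show ?thesis
        by (rule randers_metric_empty) (auto simp: slit_prod_bundle_def)
    next
      case False
      then obtain p1 p2 where "p1 \<in> (\<Union>c\<in>A1. fst c)" "p2 \<in> (\<Union>d\<in>A2. fst d)"
        unfolding prod_atlas_domain by blast
      then obtain w1 w2 where w: "(p1, w1) \<in> slit_bundle A1" "(p2, w2) \<in> slit_bundle A2"
        using slit_bundle_fibre_nonempty[OF M1] slit_bundle_fibre_nonempty[OF M2] by blast
      have \<beta>1: "\<beta>1 x v = 0" if "(x, v) \<in> slit_bundle A1" for x v
        using bspec[OF bspec[OF zero that, simplified] w(2)] by simp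
      have \<beta>2: "\<beta>2 x v = 0" if "(x, v) \<in> slit_bundle A2" for x v
        using bspec[OF bspec[OF zero w(1), simplified] that] by simp
      show ?thesis
        by (rule forms_vanish_imp_warped_randers[OF M1 M2 R1 R2 assms(5) f1 assms(7) f2 G \<beta>1 \<beta>2])
    qed
  qed
  then show ?thesis
    unfolding same_ratio_iff_forms_vanish[OF M1 M2 R1 R2] .
qed

end
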